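(* Let $\mathfrak h$ be a topological Lie algebra, $V$ a topological $\mathfrak h$-module, $\omega\in C^2(\mathfrak h,V)$, $G$ a connected Lie group with Lie algebra $\mathfrak g$, $\zeta:\mathfrak g\to\mathrm{ham}(\mathfrak h,\omega)$ a continuous Lie algebra homomorphism, $\rho_V$ an abstract hamiltonian $G$-action on $V$ for $\zeta$, and $J\in C^1(\mathfrak g,V_\omega)$ a momentum map for $\zeta$. The object measuring the failure of $J$ to be $G$-equivariant is the group $1$-cocycle $$\kappa:G\to C^1(\mathfrak g,V^{\mathfrak h}),\qquad \kappa(g)=g.J-J$$ (that is, $\kappa$ is a $1$-cocycle with values in $C^1(\mathfrak g,V^{\mathfrak h})$, and $J$ is $G$-equivariant if and only if $\kappa=0$). Its cohomology class $[\kappa]\in H^1(G,C^1(\mathfrak g,V^{\mathfrak h}))$ does not depend on the choice of the momentum map $J$. It is the obstruction for the existence of a $G$-equivariant momentum map for $\zeta$: such a momentum map exists if and only if $[\kappa]=0$.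
   Context: Lie groups may be infinite-dimensional (modelled on locally convex spaces); $V$ is locally convex. Cochains are continuous Chevalley–Eilenberg cochains with differential $d_{\mathfrak h}$; $(d_{\mathfrak h}v)(\xi)=\xi.v$; $i_\xi$ is insertion in the first argument; $(\mathcal L_\xi\omega)(\eta,\nu)=\xi.\omega(\eta,\nu)-\omega([\xi,\eta],\nu)-\omega(\eta,[\xi,\nu])$. $\mathrm{sp}(\mathfrak h,\omega)=\{\xi\in\mathfrak h:\mathcal L_\xi\omega=0,\ i_\xi d_{\mathfrak h}\omega=0\}$; $\mathrm{ham}(\mathfrak h,\omega)=\{\xi\in\mathrm{sp}(\mathfrak h,\omega):(\exists v\in V)\ i_\xi\omega=d_{\mathfrak h}v\}$; $V_\omega=\{v\in V:(\exists\xi\in\mathrm{ham}(\mathfrak h,\omega))\ d_{\mathfrak h}v=i_\xi\omega\}$; $V^{\mathfrak h}=\{v\in V:\mathfrak h.v=0\}$. A momentum map for $\zeta$ is a continuous linear map $J:\mathfrak g\to V_\omega$ with $d_{\mathfrak h}(J(X))=i_{\zeta(X)}\omega$ for all $X\in\mathfrak g$. An abstract hamiltonian $G$-action for $\zeta$ is a smooth linear action $\rho_V$ of $G$ on $V$ whose derived $\mathfrak g$-action is $X.v=\zeta(X).v$. $G$ acts on $C^1(\mathfrak g,V)$ (continuous linear maps $\mathfrak g\to V$) by $(g.c)(Y)=g.c(\mathrm{Ad}(g)^{-1}Y)$; $C^1(\mathfrak g,V^{\mathfrak h})$ is invariant under this action. $J$ is $G$-equivariant if $J(\mathrm{Ad}(g)X)=g.J(X)$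 for all $g\in G$, $X\in\mathfrak g$. A $1$-coboundary with values in $C^1(\mathfrak g,V^{\mathfrak h})$ is a map of the form $g\mapsto g.c-c$ with $c\in C^1(\mathfrak g,V^{\mathfrak h})$. *)

theory Defs
  imports "HOL-Analysis.Analysis" "HOL-Algebra.Coset"
begin

section \<open>Topological vector spaces\<close>

text \<open>All vector spaces are real. A topological vector space need not be Hausdorff; following the
  usual convention of infinite-dimensional Lie theory, a locally convex space is Hausdorff.\<close>

class tvs = real_vector + topological_ab_group_add +
  assumes tendsto_scaleR_Pair:
    "LIM z (nhds r \<times>\<^sub>F nhds x). fst z *\<^sub>R snd z :> nhds (r *\<^sub>R x)"

class lcs = tvs + t2_space +
  assumes convex_nhd_basis: \<comment> \<open>the last conjunct is \<^const>\<open>convex\<close>, which is not available in the class\<close>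
    "open U \<Longrightarrow> 0 \<in> U \<Longrightarrow> \<exists>W. open W \<and> 0 \<in> W \<and> W \<subseteq> U \<and>
      (\<forall>x\<in>W. \<forall>y\<in>W. \<forall>u\<ge>0. \<forall>v\<ge>0. u + v = 1 \<longrightarrow> u *\<^sub>R x + v *\<^sub>R y \<in> W)"

lemma lcs_convex_nhd:
  fixes U :: "'a::lcs set"
  assumes "open U" "0 \<in> U"
  obtains W where "open W" "convex W" "0 \<in> W" "W \<subseteq> U"
  using convex_nhd_basis[OF assms] unfolding convex_def by blast


section \<open>Smooth maps between locally convex spaces (Michal-Bastiani calculus)\<close>

definition has_dderiv ::
    "('a::real_vector \<Rightarrow> 'b::{real_vector,topological_space}) \<Rightarrow> 'a \<Rightarrow> 'a \<Rightarrow> 'b \<Rightarrow> bool"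
  where "has_dderiv f x h D \<longleftrightarrow> ((\<lambda>t::real. (f (x + t *\<^sub>R h) - f x) /\<^sub>R t) \<longlongrightarrow> D) (at 0)"

definition dderiv ::
    "('a::real_vector \<Rightarrow> 'b::{real_vector,t2_space}) \<Rightarrow> 'a \<Rightarrow> 'a \<Rightarrow> 'b"
  where "dderiv f x h = Lim (at 0) (\<lambda>t::real. (f (x + t *\<^sub>R h) - f x) /\<^sub>R t)"

text \<open>\<open>iter_dderiv f h k x\<close> is the iterated directional derivative
  \<open>d\<^sup>k f (x; h 0, \<dots>, h (k - 1))\<close>; it does not depend on \<open>h i\<close> for \<open>i \<ge> k\<close>.\<close>

primrec iter_dderiv ::
    "('a::real_vector \<Rightarrow> 'b::{real_vector,t2_space}) \<Rightarrow> (nat \<Rightarrow> 'a) \<Rightarrow> nat \<Rightarrow> 'a \<Rightarrow> 'b"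
  where
    "iter_dderiv f h 0 = f"
  | "iter_dderiv f h (Suc k) = (\<lambda>x. dderiv (iter_dderiv f h k) x (h k))"

text \<open>A map on an open set is smooth if all its iterated directional derivatives exist and
  \<open>d\<^sup>k f : S \<times> E\<^sup>k \<rightarrow> F\<close> is continuous for every \<open>k\<close>. The \<open>k\<close> directions are the first entries of a
  sequence; since only these entries matter, continuity for the product topology on
  \<open>S \<times> (nat \<Rightarrow> E)\<close> is the same as continuity on \<open>S \<times> E\<^sup>k\<close>.\<close>

definition smooth_on ::
    "'a::{real_vector,topological_space} set \<Rightarrow> ('a \<Rightarrow> 'b::{real_vector,t2_space}) \<Rightarrow> bool"
  where "smooth_on S f \<longleftrightarrow>
    open S \<and>
    (\<forall>k. (\<forall>h. \<forall>x\<in>S. \<exists>D. has_dderiv (iter_dderiv f h k) x (h k) D) \<and>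
         continuous_on (S \<times> UNIV) (\<lambda>(x, h). iter_dderiv f h k x))"


section \<open>Manifolds modelled on a locally convex space\<close>

text \<open>A chart is a pair of its domain and its coordinate map; only the values of the coordinate map
  on the domain matter.\<close>

type_synonym ('p, 'e) chart = "'p set \<times> ('p \<Rightarrow> 'e)"

abbreviation chart_inv :: "('p, 'e) chart \<Rightarrow> 'e \<Rightarrow> 'p"
  where "chart_inv c \<equiv> inv_into (fst c) (snd c)"

definition smooth_manifold ::
    "'p topology \<Rightarrow> ('p, 'e::{real_vector,t2_space}) chart set \<Rightarrow> bool"
  where "smooth_manifold T A \<longleftrightarrow>
    Hausdorff_space T \<and>
    topspace T = (\<Union>c\<in>A. fst c) \<and>
    (\<forall>c\<in>A. openin T (fst c) \<and> open (snd c ` fst c) \<and>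
       homeomorphic_map (subtopology T (fst c)) (top_of_set (snd c ` fst c)) (snd c)) \<and>
    (\<forall>c\<in>A. \<forall>c'\<in>A. smooth_on (snd c ` (fst c \<inter> fst c')) (snd c' \<circ> chart_inv c))"

definition prod_atlas ::
    "('p, 'e) chart set \<Rightarrow> ('q, 'f) chart set \<Rightarrow> ('p \<times> 'q, 'e \<times> 'f) chart set"
  where "prod_atlas A B = {(fst a \<times> fst b, map_prod (snd a) (snd b)) | a b. a \<in> A \<and> b \<in> B}"

definition vs_atlas :: "('e, 'e) chart set"
  where "vs_atlas = {(UNIV, id)}"

definition smooth_map ::
    "'p topology \<Rightarrow> ('p, 'e::{real_vector,topological_space}) chart set \<Rightarrow>
     'q topology \<Rightarrow> ('q, 'f::{real_vector,t2_space}) chart set \<Rightarrow> ('p \<Rightarrow> 'q) \<Rightarrow> bool"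
  where "smooth_map T A T' B f \<longleftrightarrow>
    continuous_map T T' f \<and>
    (\<forall>a\<in>A. \<forall>b\<in>B.
      smooth_on (snd a ` (fst a \<inter> f -` fst b)) (snd b \<circ> f \<circ> chart_inv a))"


section \<open>Lie groups and their Lie algebras\<close>

text \<open>A Lie group modelled on \<open>'e\<close> together with its Lie algebra, realized on the space \<open>'x\<close>. The
  identification of \<open>'x\<close> with the tangent space at the identity is recorded by a chart \<open>chart1\<close>
  around the identity and by the linear homeomorphism \<open>tangent\<close> from \<open>'x\<close> onto \<open>'e\<close> that assigns
  to a tangent vector its coordinates with respect to this chart. Neither the chart nor the
  identification is restricted any further.\<close>

record ('a, 'e, 'x) lie_group = "'a monoid" +
  gtop :: "'a topology"
  atlas :: "('a, 'e) chart set"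
  chart1 :: "('a, 'e) chart"
  tangent :: "'x \<Rightarrow> 'e"

definition is_lie_group :: "('a, 'e::lcs, 'x::lcs) lie_group \<Rightarrow> bool"
  where "is_lie_group G \<longleftrightarrow>
    group G \<and>
    topspace (gtop G) = carrier G \<and>
    smooth_manifold (gtop G) (atlas G) \<and>
    smooth_map (prod_topology (gtop G) (gtop G)) (prod_atlas (atlas G) (atlas G))
      (gtop G) (atlas G) (\<lambda>(g, h). g \<otimes>\<^bsub>G\<^esub> h) \<and>
    smooth_map (gtop G) (atlas G) (gtop G) (atlas G) (\<lambda>g. inv\<^bsub>G\<^esub> g) \<and>
    chart1 G \<in> atlas G \<and> \<one>\<^bsub>G\<^esub> \<in> fst (chart1 G) \<and>
    linear (tangent G) \<and> homeomorphic_map euclidean euclidean (tangent G)"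

definition connected_lie_group :: "('a, 'e::lcs, 'x::lcs) lie_group \<Rightarrow> bool"
  where "connected_lie_group G \<longleftrightarrow> is_lie_group G \<and> connected_space (gtop G)"

definition base_pt :: "('a, 'e, 'x) lie_group \<Rightarrow> 'e"
  where "base_pt G = snd (chart1 G) \<one>\<^bsub>G\<^esub>"

definition from_tangent :: "('a, 'e, 'x) lie_group \<Rightarrow> 'e \<Rightarrow> 'x"
  where "from_tangent G = inv_into UNIV (tangent G)"

text \<open>The left invariant vector field \<open>g \<mapsto> T(L\<^sub>g) X\<close> in the coordinates \<open>chart1\<close>, on the image of
  that chart.\<close>

definition left_inv_field :: "('a, 'e::lcs, 'x) lie_group \<Rightarrow> 'x \<Rightarrow> 'e \<Rightarrow> 'e"
  where "left_inv_field G X p =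
    dderiv (\<lambda>q. snd (chart1 G) (chart_inv (chart1 G) p \<otimes>\<^bsub>G\<^esub> chart_inv (chart1 G) q))
      (base_pt G) (tangent G X)"

text \<open>The value at the identity of the Lie bracket of two left invariant vector fields; in
  coordinates the bracket of vector fields is \<open>[\<xi>, \<eta>](p) = d\<eta>(p)(\<xi>(p)) - d\<xi>(p)(\<eta>(p))\<close>.\<close>

definition lie_bracket :: "('a, 'e::lcs, 'x) lie_group \<Rightarrow> 'x \<Rightarrow> 'x \<Rightarrow> 'x"
  where "lie_bracket G X Y = from_tangent G
    (dderiv (left_inv_field G Y) (base_pt G) (left_inv_field G X (base_pt G)) -
     dderiv (left_inv_field G X) (base_pt G) (left_inv_field G Y (base_pt G)))"

text \<open>\<open>Ad g\<close> is the tangent map at the identity of the conjugation \<open>x \<mapsto> g x g\<^sup>-\<^sup>1\<close>.\<close>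

definition Ad :: "('a, 'e::lcs, 'x) lie_group \<Rightarrow> 'a \<Rightarrow> 'x \<Rightarrow> 'x"
  where "Ad G g X = from_tangent G
    (dderiv (\<lambda>p. snd (chart1 G) (g \<otimes>\<^bsub>G\<^esub> chart_inv (chart1 G) p \<otimes>\<^bsub>G\<^esub> inv\<^bsub>G\<^esub> g))
      (base_pt G) (tangent G X))"

definition smooth_linear_action ::
    "('a, 'e::lcs, 'x::lcs) lie_group \<Rightarrow> ('a \<Rightarrow> 'v::lcs \<Rightarrow> 'v) \<Rightarrow> bool"
  where "smooth_linear_action G \<rho> \<longleftrightarrow>
    (\<forall>g\<in>carrier G. linear (\<rho> g)) \<and>
    (\<forall>v. \<rho> \<one>\<^bsub>G\<^esub> v = v) \<and>
    (\<forall>g\<in>carrier G. \<forall>h\<in>carrier G. \<forall>v. \<rho> (g \<otimes>\<^bsub>G\<^esub> h) v = \<rho> g (\<rho> h v)) \<and>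
    smooth_map (prod_topology (gtop G) euclidean) (prod_atlas (atlas G) vs_atlas)
      euclidean vs_atlas (\<lambda>(g, v). \<rho> g v)"

definition derived_action ::
    "('a, 'e::lcs, 'x::lcs) lie_group \<Rightarrow> ('a \<Rightarrow> 'v::lcs \<Rightarrow> 'v) \<Rightarrow> 'x \<Rightarrow> 'v \<Rightarrow> 'v"
  where "derived_action G \<rho> X v =
    dderiv (\<lambda>p. \<rho> (chart_inv (chart1 G) p) v) (base_pt G) (tangent G X)"


section \<open>Topological Lie algebras, modules and cochains\<close>

locale topological_lie_algebra =
  fixes br :: "'h::tvs \<Rightarrow> 'h \<Rightarrow> 'h"
  assumes br_bilinear: "bilinear br"
    and br_alternating: "br x x = 0"
    and br_jacobi: "br x (br y z) + br y (br z x) + br z (br x y) = 0"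
    and br_continuous: "continuous_on UNIV (\<lambda>(x, y). br x y)"

locale topological_lie_module = topological_lie_algebra br
  for br :: "'h::tvs \<Rightarrow> 'h \<Rightarrow> 'h" +
  fixes act :: "'h \<Rightarrow> 'v::lcs \<Rightarrow> 'v"
  assumes act_bilinear: "bilinear act"
    and act_br: "act (br x y) v = act x (act y v) - act y (act x v)"
    and act_continuous: "continuous_on UNIV (\<lambda>(x, v). act x v)"

definition C1 :: "'v::tvs set \<Rightarrow> ('x::tvs \<Rightarrow> 'v) set"
  where "C1 W = {c. linear c \<and> continuous_on UNIV c \<and> range c \<subseteq> W}"

definition C2 :: "('h::tvs \<Rightarrow> 'h \<Rightarrow> 'v::tvs) set"
  where "C2 = {\<omega>. bilinear \<omega> \<and> (\<forall>\<xi>. \<omega> \<xi> \<xi> = 0) \<and> continuous_on UNIV (\<lambda>(\<xi>, \<eta>). \<omega> \<xi> \<eta>)}"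

text \<open>The Chevalley-Eilenberg differential on 0-cochains and on 2-cochains. Cochains are curried, so
  the insertion \<open>i\<^sub>\<xi> \<omega>\<close> in the first argument is the application \<open>\<omega> \<xi>\<close>.\<close>

definition d0 :: "('h \<Rightarrow> 'v \<Rightarrow> 'v) \<Rightarrow> 'v \<Rightarrow> 'h \<Rightarrow> 'v"
  where "d0 act v = (\<lambda>\<xi>. act \<xi> v)"

definition d2 ::
    "('h \<Rightarrow> 'h \<Rightarrow> 'h) \<Rightarrow> ('h \<Rightarrow> 'v::ab_group_add \<Rightarrow> 'v) \<Rightarrow> ('h \<Rightarrow> 'h \<Rightarrow> 'v) \<Rightarrow> 'h \<Rightarrow> 'h \<Rightarrow> 'h \<Rightarrow> 'v"
  where "d2 br act \<omega> = (\<lambda>\<xi> \<eta> \<nu>.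
    act \<xi> (\<omega> \<eta> \<nu>) - act \<eta> (\<omega> \<xi> \<nu>) + act \<nu> (\<omega> \<xi> \<eta>)
    - \<omega> (br \<xi> \<eta>) \<nu> + \<omega> (br \<xi> \<nu>) \<eta> - \<omega> (br \<eta> \<nu>) \<xi>)"

definition lie_deriv ::
    "('h \<Rightarrow> 'h \<Rightarrow> 'h) \<Rightarrow> ('h \<Rightarrow> 'v::ab_group_add \<Rightarrow> 'v) \<Rightarrow> 'h \<Rightarrow> ('h \<Rightarrow> 'h \<Rightarrow> 'v) \<Rightarrow> 'h \<Rightarrow> 'h \<Rightarrow> 'v"
  where "lie_deriv br act \<xi> \<omega> = (\<lambda>\<eta> \<nu>. act \<xi> (\<omega> \<eta> \<nu>) - \<omega> (br \<xi> \<eta>) \<nu> - \<omega> \<eta> (br \<xi> \<nu>))"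

definition sp ::
    "('h \<Rightarrow> 'h \<Rightarrow> 'h) \<Rightarrow> ('h \<Rightarrow> 'v::ab_group_add \<Rightarrow> 'v) \<Rightarrow> ('h \<Rightarrow> 'h \<Rightarrow> 'v) \<Rightarrow> 'h set"
  where "sp br act \<omega> =
    {\<xi>. lie_deriv br act \<xi> \<omega> = (\<lambda>\<eta> \<nu>. 0) \<and> d2 br act \<omega> \<xi> = (\<lambda>\<eta> \<nu>. 0)}"

definition ham ::
    "('h \<Rightarrow> 'h \<Rightarrow> 'h) \<Rightarrow> ('h \<Rightarrow> 'v::ab_group_add \<Rightarrow> 'v) \<Rightarrow> ('h \<Rightarrow> 'h \<Rightarrow> 'v) \<Rightarrow> 'h set"
  where "ham br act \<omega> = {\<xi> \<in> sp br act \<omega>. \<exists>v. \<omega> \<xi> = d0 act v}"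

definition V_ham ::
    "('h \<Rightarrow> 'h \<Rightarrow> 'h) \<Rightarrow> ('h \<Rightarrow> 'v::ab_group_add \<Rightarrow> 'v) \<Rightarrow> ('h \<Rightarrow> 'h \<Rightarrow> 'v) \<Rightarrow> 'v set"
  where "V_ham br act \<omega> = {v. \<exists>\<xi>\<in>ham br act \<omega>. d0 act v = \<omega> \<xi>}"

definition V_inv :: "('h \<Rightarrow> 'v::zero \<Rightarrow> 'v) \<Rightarrow> 'v set"
  where "V_inv act = {v. \<forall>\<xi>. act \<xi> v = 0}"


section \<open>Momentum maps\<close>

definition ham_hom ::
    "('a, 'e::lcs, 'x::lcs) lie_group \<Rightarrow> ('h::tvs \<Rightarrow> 'h \<Rightarrow> 'h) \<Rightarrow> ('h \<Rightarrow> 'v::lcs \<Rightarrow> 'v) \<Rightarrow>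
     ('h \<Rightarrow> 'h \<Rightarrow> 'v) \<Rightarrow> ('x \<Rightarrow> 'h) \<Rightarrow> bool"
  where "ham_hom G br act \<omega> \<zeta> \<longleftrightarrow>
    linear \<zeta> \<and> continuous_on UNIV \<zeta> \<and> range \<zeta> \<subseteq> ham br act \<omega> \<and>
    (\<forall>X Y. \<zeta> (lie_bracket G X Y) = br (\<zeta> X) (\<zeta> Y))"

definition hamiltonian_action ::
    "('a, 'e::lcs, 'x::lcs) lie_group \<Rightarrow> ('h::tvs \<Rightarrow> 'v::lcs \<Rightarrow> 'v) \<Rightarrow> ('x \<Rightarrow> 'h) \<Rightarrow>
     ('a \<Rightarrow> 'v \<Rightarrow> 'v) \<Rightarrow> bool"
  where "hamiltonian_action G act \<zeta> \<rho> \<longleftrightarrow>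
    smooth_linear_action G \<rho> \<and> (\<forall>X v. derived_action G \<rho> X v = act (\<zeta> X) v)"

definition momentum_map ::
    "('h::tvs \<Rightarrow> 'h \<Rightarrow> 'h) \<Rightarrow> ('h \<Rightarrow> 'v::lcs \<Rightarrow> 'v) \<Rightarrow> ('h \<Rightarrow> 'h \<Rightarrow> 'v) \<Rightarrow>
     ('x::lcs \<Rightarrow> 'h) \<Rightarrow> ('x \<Rightarrow> 'v) \<Rightarrow> bool"
  where "momentum_map br act \<omega> \<zeta> J \<longleftrightarrow>
    J \<in> C1 (V_ham br act \<omega>) \<and> (\<forall>X. d0 act (J X) = \<omega> (\<zeta> X))"

definition equivariant ::
    "('a, 'e::lcs, 'x::lcs) lie_group \<Rightarrow> ('a \<Rightarrow> 'v \<Rightarrow> 'v) \<Rightarrow> ('x \<Rightarrow> 'v) \<Rightarrow> bool"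
  where "equivariant G \<rho> J \<longleftrightarrow> (\<forall>g\<in>carrier G. \<forall>X. J (Ad G g X) = \<rho> g (J X))"

definition C1_action ::
    "('a, 'e::lcs, 'x::lcs) lie_group \<Rightarrow> ('a \<Rightarrow> 'v \<Rightarrow> 'v) \<Rightarrow> 'a \<Rightarrow> ('x \<Rightarrow> 'v) \<Rightarrow> 'x \<Rightarrow> 'v"
  where "C1_action G \<rho> g c = (\<lambda>Y. \<rho> g (c (inv_into UNIV (Ad G g) Y)))"


section \<open>The first cohomology of \<open>G\<close> with values in \<open>C\<^sup>1(\<gg>, W)\<close>\<close>

text \<open>Group cochains are extensional functions on the carrier of \<open>G\<close>, with pointwise addition.\<close>

definition coboundary ::
    "('a, 'e::lcs, 'x::lcs) lie_group \<Rightarrow> ('a \<Rightarrow> 'v::lcs \<Rightarrow> 'v) \<Rightarrow> ('x \<Rightarrow> 'v) \<Rightarrow> 'a \<Rightarrow> 'x \<Rightarrow> 'v"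
  where "coboundary G \<rho> c = (\<lambda>g\<in>carrier G. \<lambda>Y. C1_action G \<rho> g c Y - c Y)"

definition Z1 ::
    "('a, 'e::lcs, 'x::lcs) lie_group \<Rightarrow> ('a \<Rightarrow> 'v::lcs \<Rightarrow> 'v) \<Rightarrow> 'v set \<Rightarrow> ('a \<Rightarrow> 'x \<Rightarrow> 'v) monoid"
  where "Z1 G \<rho> W =
    \<lparr>carrier = {f \<in> carrier G \<rightarrow>\<^sub>E C1 W. \<forall>g\<in>carrier G. \<forall>h\<in>carrier G.
        f (g \<otimes>\<^bsub>G\<^esub> h) = (\<lambda>Y. f g Y + C1_action G \<rho> g (f h) Y)},
     monoid.mult = (\<lambda>f f'. \<lambda>g\<in>carrier G. \<lambda>Y. f g Y + f' g Y),
     one = (\<lambda>g\<in>carrier G. \<lambda>Y. 0)\<rparr>"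

definition B1 ::
    "('a, 'e::lcs, 'x::lcs) lie_group \<Rightarrow> ('a \<Rightarrow> 'v::lcs \<Rightarrow> 'v) \<Rightarrow> 'v set \<Rightarrow> ('a \<Rightarrow> 'x \<Rightarrow> 'v) set"
  where "B1 G \<rho> W = coboundary G \<rho> ` C1 W"

definition H1 ::
    "('a, 'e::lcs, 'x::lcs) lie_group \<Rightarrow> ('a \<Rightarrow> 'v::lcs \<Rightarrow> 'v) \<Rightarrow> 'v set \<Rightarrow> ('a \<Rightarrow> 'x \<Rightarrow> 'v) set monoid"
  where "H1 G \<rho> W = Z1 G \<rho> W Mod B1 G \<rho> W"

definition H1_class ::
    "('a, 'e::lcs, 'x::lcs) lie_group \<Rightarrow> ('a \<Rightarrow> 'v::lcs \<Rightarrow> 'v) \<Rightarrow> 'v set \<Rightarrow>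
     ('a \<Rightarrow> 'x \<Rightarrow> 'v) \<Rightarrow> ('a \<Rightarrow> 'x \<Rightarrow> 'v) set"
  where "H1_class G \<rho> W f = B1 G \<rho> W #>\<^bsub>Z1 G \<rho> W\<^esub> f"

text \<open>The formula of a coboundary, but \<open>J\<close> takes its values in \<open>V_ham\<close> rather than in \<open>V_inv\<close>.\<close>

definition momentum_cocycle ::
    "('a, 'e::lcs, 'x::lcs) lie_group \<Rightarrow> ('a \<Rightarrow> 'v::lcs \<Rightarrow> 'v) \<Rightarrow> ('x \<Rightarrow> 'v) \<Rightarrow> 'a \<Rightarrow> 'x \<Rightarrow> 'v"
  where "momentum_cocycle G \<rho> J = (\<lambda>g\<in>carrier G. \<lambda>Y. C1_action G \<rho> g J Y - J Y)"

end

theory Submission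
  imports Defs
begin

text \<open>
  The cohomological part is formal. By definition \<open>\<kappa> = g.J - J\<close> looks like a
  coboundary, so it satisfies the cocycle identity. Two momentum maps have the same differential, hence they differ by
  an element of \<open>C\<^sup>1(\<gg>, V\<^sup>\<hh>)\<close>, and conversely subtracting such an element from a momentum map gives a momentum
  map again. So \<open>[\<kappa>]\<close> does not depend on \<open>J\<close>, and \<open>\<kappa> = g.c - c\<close> with \<open>c \<in> C\<^sup>1(\<gg>, V\<^sup>\<hh>)\<close> means
  that \<open>J - c\<close> is equivariant.

  The substance is that \<open>\<kappa>(g)(Y)\<close> is \<open>\<hh>\<close>-invariant. As \<open>G\<close> does not act on \<open>\<hh>\<close>, this cannot be
  seen by transporting \<open>\<omega>\<close> along \<open>g\<close>; it is proved infinitesimally. The elements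
  \<open>X.J(Z) - J([X, Z])\<close> are invariant, because both terms have the differential
  \<open>i\<^bsub>[\<zeta> X, \<zeta> Z]\<^esub> \<omega>\<close> (\<open>infinitesimal_cocycle_invariant\<close>). Up to the action of \<open>g\<close>, with \<open>Z = Ad(g)\<inverse> Y\<close>,
  they are the derivatives of \<open>g \<mapsto> (g.J)(Y)\<close> (\<open>C1_action_has_hderiv\<close>). Moreover \<open>G\<close> acts trivially
  on \<open>V\<^sup>\<hh>\<close>, because the derived action vanishes there (\<open>\<rho>_eq_id_if_derived_action_zero\<close>). Hence for each
  \<open>\<xi> \<in> \<hh>\<close> the function \<open>g \<mapsto> \<xi>.(g.J)(Y)\<close> has derivative zero. On a connected group it is constant
  (\<open>constant_if_derivative_zero\<close>), so \<open>\<xi>.\<kappa>(g)(Y)\<close> equals its value \<open>0\<close> at the identity.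

  The analysis takes place in locally convex spaces that need not be complete. It rests on a mean
  value theorem for open convex sets (\<open>mean_value_convex\<close>), proved by bisection. That theorem yields the chain rule
  along curves, the linearity of derivatives and the symmetry of second derivatives. The last is needed to see that the
  derivative of \<open>Ad\<close> is the Lie bracket of left invariant vector fields (\<open>Ad_has_hderiv\<close>).
\<close>

section \<open>Topological vector spaces\<close>

text \<open>The multiplication of a Lie group and a linear action are differentiated on \<open>E \<times> F\<close>, so products of
  topological vector spaces have to be topological vector spaces again.\<close>

instance prod :: (topological_monoid_add, topological_monoid_add) topological_monoid_add
proof
  fix a b :: "'a \<times> 'b"
  have "((\<lambda>x. (fst (fst x) + fst (snd x), snd (fst x) + snd (snd x))) \<longlongrightarrow> (fst a + fst b, snd a + snd b))
     (nhds a \<times>\<^sub>F nhds b)"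
    by (intro tendsto_intros filterlim_fst filterlim_snd)
  then show "LIM x (nhds a \<times>\<^sub>F nhds b). fst x + snd x :> nhds (a + b)"
    by (simp add: plus_prod_def)
qed

instance prod :: (topological_group_add, topological_group_add) topological_group_add
proof
  fix a :: "'a \<times> 'b"
  have "((\<lambda>x. (- fst x, - snd x)) \<longlongrightarrow> (- fst a, - snd a)) (nhds a)"
    by (intro tendsto_intros filterlim_ident)
  moreover have "(\<lambda>x. (- fst x, - snd x)) = (uminus :: 'a \<times> 'b \<Rightarrow> _)"
    by (auto simp: uminus_prod_def)
  ultimately show "(uminus \<longlongrightarrow> - a) (nhds a)"
    by (simp add: uminus_prod_def)
qed

instance prod :: (topological_ab_group_add, topological_ab_group_add) topological_ab_group_add ..

lemma tendsto_scaleR_tvs: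
  fixes g :: "'c \<Rightarrow> 'a::tvs"
  assumes "(f \<longlongrightarrow> r) F" "(g \<longlongrightarrow> x) F"
  shows "((\<lambda>z. f z *\<^sub>R g z) \<longlongrightarrow> r *\<^sub>R x) F"
  using filterlim_compose[OF tendsto_scaleR_Pair filterlim_Pair[OF assms]] by simp

instance prod :: (tvs, tvs) tvs
proof
  fix r :: real and x :: "'a \<times> 'b"
  have "((\<lambda>z. (fst z *\<^sub>R fst (snd z), fst z *\<^sub>R snd (snd z))) \<longlongrightarrow> (r *\<^sub>R fst x, r *\<^sub>R snd x))
     (nhds r \<times>\<^sub>F nhds x)"
    by (intro tendsto_intros filterlim_fst filterlim_snd tendsto_scaleR_tvs)
  then show "LIM z (nhds r \<times>\<^sub>F nhds x). fst z *\<^sub>R snd z :> nhds (r *\<^sub>R x)"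
    by (simp add: scaleR_prod_def)
qed

lemma continuous_on_scaleR_tvs:
  fixes g :: "'c::topological_space \<Rightarrow> 'a::tvs"
  assumes "continuous_on S f" "continuous_on S g"
  shows "continuous_on S (\<lambda>z. f z *\<^sub>R g z)"
  using assms by (auto simp: continuous_on_def intro!: tendsto_scaleR_tvs)

lemma lcs_convex_nhd_at:
  fixes U :: "'a::lcs set"
  assumes "open U" "x \<in> U"
  obtains C where "open C" "convex C" "x \<in> C" "C \<subseteq> U"
proof -
  have "open ((\<lambda>y. x + y) -` U)"
    by (intro open_vimage assms continuous_intros)
  then obtain W where W: "open W" "convex W" "0 \<in> W" "W \<subseteq> (\<lambda>y. x + y) -` U"
    using lcs_convex_nhd[of "(\<lambda>y. x + y) -` U"] assms by auto
  have "open ((\<lambda>y. y - x) -` W)"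
    by (intro open_vimage W continuous_intros)
  moreover have "(\<lambda>y. y - x) -` W = (+) x ` W"
    by (force simp: image_iff algebra_simps)
  ultimately show ?thesis
    using W by (intro that[of "(+) x ` W"]) (auto intro: convex_translation)
qed

section \<open>Velocities of curves and the mean value theorem\<close>

definition has_velocity :: "(real \<Rightarrow> 'a::{real_vector,topological_space}) \<Rightarrow> 'a \<Rightarrow> bool"
  where "has_velocity \<gamma> h \<longleftrightarrow> ((\<lambda>s. (\<gamma> s - \<gamma> 0) /\<^sub>R s) \<longlongrightarrow> h) (at 0)"

lemma has_dderiv_iff_has_velocity: "has_dderiv f x h D \<longleftrightarrow> has_velocity (\<lambda>s. f (x + s *\<^sub>R h)) D"
  by (simp add: has_dderiv_def has_velocity_def)

lemma has_dderiv_imp_dderiv: "has_dderiv f x h D \<Longrightarrow> dderiv f x h = D"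
  unfolding has_dderiv_def dderiv_def by (rule tendsto_Lim) auto

lemma has_velocity_unique:
  fixes h :: "'a::{real_vector,t2_space}"
  shows "has_velocity \<gamma> h \<Longrightarrow> has_velocity \<gamma> k \<Longrightarrow> h = k"
  unfolding has_velocity_def by (rule tendsto_unique) auto

lemma has_velocity_imp_tendsto:
  fixes h :: "'a::tvs"
  assumes "has_velocity \<gamma> h"
  shows "(\<gamma> \<longlongrightarrow> \<gamma> 0) (at 0)"
proof -
  have "((\<lambda>s. \<gamma> 0 + s *\<^sub>R ((\<gamma> s - \<gamma> 0) /\<^sub>R s)) \<longlongrightarrow> \<gamma> 0 + 0 *\<^sub>R h) (at 0)"
    using assms unfolding has_velocity_def
    by (intro tendsto_add tendsto_scaleR_tvs tendsto_const tendsto_ident_at)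
  moreover have "\<gamma> 0 + s *\<^sub>R ((\<gamma> s - \<gamma> 0) /\<^sub>R s) = \<gamma> s" for s
    by (cases "s = 0") auto
  ultimately show ?thesis
    by simp
qed

lemma has_velocity_cong:
  assumes "\<forall>\<^sub>F s in nhds 0. \<gamma> s = \<gamma>' s"
  shows "has_velocity \<gamma> h \<longleftrightarrow> has_velocity \<gamma>' h"
proof -
  have "\<gamma> 0 = \<gamma>' 0" and "\<forall>\<^sub>F s in at 0. \<gamma> s = \<gamma>' s"
    using assms eventually_nhds_x_imp_x by (auto simp: eventually_at_filter elim: eventually_mono)
  then show ?thesis
    unfolding has_velocity_def by (intro tendsto_cong) (auto elim: eventually_mono)
qed

lemma has_velocity_const: "has_velocity (\<lambda>_. c) (0::'a::tvs)"
  by (simp add: has_velocity_def)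

lemma has_velocity_line: "has_velocity (\<lambda>s. x + s *\<^sub>R h) (h::'a::tvs)"
proof -
  have "\<forall>\<^sub>F s in at 0. h = (s *\<^sub>R h) /\<^sub>R s"
    by (auto simp: eventually_at_filter)
  then show ?thesis
    unfolding has_velocity_def by (simp add: tendsto_cong[symmetric] tendsto_eventually)
qed

lemma has_velocity_add:
  fixes h :: "'a::tvs"
  assumes "has_velocity \<gamma> h" "has_velocity \<delta> k"
  shows "has_velocity (\<lambda>s. \<gamma> s + \<delta> s) (h + k)"
  using tendsto_add[OF assms[unfolded has_velocity_def]]
  by (simp add: has_velocity_def algebra_simps scaleR_add_right scaleR_diff_right)

lemma has_velocity_linear:
  fixes h :: "'a::tvs" and L :: "'a \<Rightarrow> 'b::tvs"
  assumes "has_velocity \<gamma> h" "linear L" "continuous_on UNIV L"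
  shows "has_velocity (\<lambda>s. L (\<gamma> s)) (L h)"
proof -
  have "((\<lambda>s. L ((\<gamma> s - \<gamma> 0) /\<^sub>R s)) \<longlongrightarrow> L h) (at 0)"
    using assms by (intro continuous_on_tendsto_compose[of UNIV L]) (auto simp: has_velocity_def)
  then show ?thesis
    using assms(2) by (simp add: has_velocity_def linear_diff linear_scale)
qed

lemma has_velocity_minus:
  fixes h :: "'a::tvs"
  assumes "has_velocity \<gamma> h"
  shows "has_velocity (\<lambda>s. - \<gamma> s) (- h)"
  by (rule has_velocity_linear[OF assms])
     (auto intro!: linearI continuous_on_minus continuous_on_id)

lemma has_velocity_diff:
  fixes h :: "'a::tvs"
  assumes "has_velocity \<gamma> h" "has_velocity \<delta> k"
  shows "has_velocity (\<lambda>s. \<gamma> s - \<delta> s) (h - k)"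
  using has_velocity_add[OF assms(1) has_velocity_minus[OF assms(2)]] by simp

lemma has_velocity_Pair:
  assumes "has_velocity \<gamma> h" "has_velocity \<delta> k"
  shows "has_velocity (\<lambda>s. (\<gamma> s, \<delta> s)) (h, k)"
  using tendsto_Pair[OF assms[unfolded has_velocity_def]]
  by (simp add: has_velocity_def scaleR_prod_def)

text \<open>The case \<open>c = 0\<close> is separate because \<open>s \<mapsto> c * s\<close> then does not tend to \<open>0\<close> through nonzero
  values.\<close>

lemma has_velocity_scale_time:
  fixes h :: "'a::tvs"
  assumes "has_velocity \<gamma> h"
  shows "has_velocity (\<lambda>s. \<gamma> (c * s)) (c *\<^sub>R h)"
proof (cases "c = 0")
  case True
  then show ?thesis by (simp add: has_velocity_const)
next
  case False
  have "filterlim (\<lambda>s. c * s) (at 0) (at 0)"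
    using False by (auto simp: filterlim_at eventually_at_filter intro!: tendsto_eq_intros)
  from filterlim_compose[OF assms[unfolded has_velocity_def] this]
  have "((\<lambda>s. c *\<^sub>R ((\<gamma> (c * s) - \<gamma> 0) /\<^sub>R (c * s))) \<longlongrightarrow> c *\<^sub>R h) (at 0)"
    by (intro tendsto_scaleR_tvs tendsto_const)
  moreover have "c *\<^sub>R ((\<gamma> (c * s) - \<gamma> 0) /\<^sub>R (c * s)) = (\<gamma> (c * s) - \<gamma> 0) /\<^sub>R s" for s
    using False by simp
  ultimately show ?thesis
    by (simp only: has_velocity_def mult_zero_right)
qed

lemma quotient_swap:
  fixes u v :: "'a::real_vector"
  shows "(u - v) /\<^sub>R (a - b) = (v - u) /\<^sub>R (b - a)"
proof -
  have "u - v = - (v - u)" "a - b = - (b - a)"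
    by simp_all
  then show ?thesis
    by (simp only: inverse_minus_eq scaleR_minus_left scaleR_minus_right minus_minus)
qed

text \<open>There is no norm, and no completeness that would allow the derivative of a curve to be integrated. What
  survives of the mean value theorem is the statement for convex sets: a difference quotient over
  \<open>[x, z]\<close> is the convex combination of those over \<open>[x, y]\<close> and \<open>[y, z]\<close>, so membership in \<open>C\<close> passes from
  small intervals to large ones. Near each point, \<open>C\<close> being open, the quotients belong to \<open>C\<close>, and
  bisection does the rest.\<close>

lemma mean_value_convex_aux:
  fixes f :: "real \<Rightarrow> 'a::tvs"
  assumes ab: "a < b"
    and vel: "\<And>t. t \<in> {a..b} \<Longrightarrow> has_velocity (\<lambda>s. f (t + s)) (D t)"
    and C: "open C" "convex C" "\<And>t. t \<in> {a..b} \<Longrightarrow> D t \<in> C"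
  shows "(f b - f a) /\<^sub>R (b - a) \<in> C"
proof -
  have combine: "(f z - f x) /\<^sub>R (z - x) \<in> C"
    if "x < y" "y < z" "(f y - f x) /\<^sub>R (y - x) \<in> C" "(f z - f y) /\<^sub>R (z - y) \<in> C" for x y z
  proof -
    have "((y - x) / (z - x)) *\<^sub>R ((f y - f x) /\<^sub>R (y - x))
          + ((z - y) / (z - x)) *\<^sub>R ((f z - f y) /\<^sub>R (z - y)) \<in> C"
      using that by (intro convexD[OF C(2)]) (auto simp: add_divide_distrib[symmetric])
    moreover have "((y - x) / (z - x)) *\<^sub>R ((f y - f x) /\<^sub>R (y - x))
          + ((z - y) / (z - x)) *\<^sub>R ((f z - f y) /\<^sub>R (z - y))
        = inverse (z - x) *\<^sub>R (f y - f x) + inverse (z - x) *\<^sub>R (f z - f y)"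
      using that by (simp add: field_simps)
    moreover have "\<dots> = (f z - f x) /\<^sub>R (z - x)"
      unfolding scaleR_add_right[symmetric] by simp
    ultimately show ?thesis by simp
  qed
  \<comment> \<open>the premise \<open>a < b\<close> keeps the statement true on the degenerate intervals of the bisection\<close>
  have "a < b \<longrightarrow> (f b - f a) /\<^sub>R (b - a) \<in> C"
  proof (rule Bolzano[where P = "\<lambda>x y. x < y \<longrightarrow> (f y - f x) /\<^sub>R (y - x) \<in> C"])
    show "a \<le> b" using ab by simp
  next
    fix x y z
    assume "x < y \<longrightarrow> (f y - f x) /\<^sub>R (y - x) \<in> C" "y < z \<longrightarrow> (f z - f y) /\<^sub>R (z - y) \<in> C"
      "x \<le> y" "y \<le> z"
    then show "x < z \<longrightarrow> (f z - f x) /\<^sub>R (z - x) \<in> C"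
      using combine[of x y z] by (cases "x = y"; cases "y = z") auto
  next
    fix t assume t: "a \<le> t" "t \<le> b"
    have "\<forall>\<^sub>F s in at 0. (f (t + s) - f t) /\<^sub>R s \<in> C"
      using topological_tendstoD[OF vel[unfolded has_velocity_def] C(1) C(3)] t by simp
    then obtain d where d: "d > 0"
      and near: "\<And>s. s \<noteq> 0 \<Longrightarrow> \<bar>s\<bar> < d \<Longrightarrow> (f (t + s) - f t) /\<^sub>R s \<in> C"
      by (auto simp: eventually_at dist_real_def)
    have "x < y \<longrightarrow> (f y - f x) /\<^sub>R (y - x) \<in> C" if "x \<le> t" "t \<le> y" "y - x < d" for x y
    proof
      assume xy: "x < y"
      have right: "(f y - f t) /\<^sub>R (y - t) \<in> C" if "t < y"
        using near[of "y - t"] that \<open>x \<le> t\<close> \<open>y - x < d\<close> by auto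
      have left: "(f t - f x) /\<^sub>R (t - x) \<in> C" if "x < t"
      proof -
        have "(f (t + (x - t)) - f t) /\<^sub>R (x - t) \<in> C"
          using near[of "x - t"] that \<open>t \<le> y\<close> \<open>y - x < d\<close> by auto
        moreover have "(f x - f t) /\<^sub>R (x - t) = (f t - f x) /\<^sub>R (t - x)"
          by (rule quotient_swap)
        ultimately show ?thesis by simp
      qed
      show "(f y - f x) /\<^sub>R (y - x) \<in> C"
      proof -
        consider "x = t" | "t = y" | "x < t" "t < y"
          using \<open>x \<le> t\<close> \<open>t \<le> y\<close> by linarith
        then show ?thesis
        proof cases
          case 1
          then show ?thesis using right xy by blast
        next
          case 2
          then show ?thesis using left xy by blast
        next
          case 3
          then show ?thesis using combine left right by blast
        qed
      qed
    qed
    then show "\<exists>d>0. \<forall>x y. x \<le> t \<and> t \<le> y \<and> y - x < d \<longrightarrow> (x < y \<longrightarrow> (f y - f x) /\<^sub>R (y - x) \<in> C)"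
      using d by blast
  qed
  then show ?thesis using ab by simp
qed

text \<open>The difference quotient is symmetric in its two end points, so their order does not matter. The
  applications have an end point \<open>s\<close> of unknown sign.\<close>

lemma mean_value_convex:
  fixes f :: "real \<Rightarrow> 'a::tvs"
  assumes "a \<noteq> b"
    and "\<And>t. t \<in> closed_segment a b \<Longrightarrow> has_velocity (\<lambda>s. f (t + s)) (D t)"
    and "open C" "convex C" "\<And>t. t \<in> closed_segment a b \<Longrightarrow> D t \<in> C"
  shows "(f b - f a) /\<^sub>R (b - a) \<in> C"
proof (cases "a < b")
  case True
  then show ?thesis
    using assms by (intro mean_value_convex_aux[of a b f D]) (auto simp: closed_segment_eq_real_ivl)
next
  case False
  then have "(f a - f b) /\<^sub>R (a - b) \<in> C"
    using assms by (intro mean_value_convex_aux[of b a f D]) (auto simp: closed_segment_eq_real_ivl)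
  moreover have "(f a - f b) /\<^sub>R (a - b) = (f b - f a) /\<^sub>R (b - a)"
    by (rule quotient_swap)
  ultimately show ?thesis by simp
qed

text \<open>Convex neighbourhoods separate points, so a nonzero difference quotient would miss one that contains the
  velocity \<open>0\<close>.\<close>

lemma zero_velocity_imp_const:
  fixes f :: "real \<Rightarrow> 'a::lcs"
  assumes "\<And>t. t \<in> closed_segment a b \<Longrightarrow> has_velocity (\<lambda>s. f (t + s)) 0"
  shows "f a = f b"
proof (rule ccontr)
  assume ne: "f a \<noteq> f b"
  then have "a \<noteq> b" by auto
  have "(f b - f a) /\<^sub>R (b - a) \<noteq> 0"
    using ne \<open>a \<noteq> b\<close> by simp
  from hausdorff[OF this[symmetric]] obtain U V
    where U: "open U" "0 \<in> U" "(f b - f a) /\<^sub>R (b - a) \<in> V" "U \<inter> V = {}"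
    by auto
  obtain C where C: "open C" "convex C" "0 \<in> C" "C \<subseteq> U"
    using U(1,2) by (rule lcs_convex_nhd)
  have "(f b - f a) /\<^sub>R (b - a) \<in> C"
    by (rule mean_value_convex[OF \<open>a \<noteq> b\<close> assms C(1,2,3)])
  then show False
    using U(3,4) C(4) by auto
qed

section \<open>Continuously differentiable maps\<close>

text \<open>Differentiability in the sense of Hadamard: differentiable curves through \<open>x\<close> are mapped to
  differentiable curves, and \<open>D\<close> transforms the velocities. The chain rule is then immediate.\<close>

definition has_hderiv ::
    "('a::{real_vector,topological_space} \<Rightarrow> 'b::{real_vector,topological_space}) \<Rightarrow> 'a \<Rightarrow> ('a \<Rightarrow> 'b) \<Rightarrow> bool"
  where "has_hderiv f x D \<longleftrightarrow>
    (\<forall>\<gamma> h. \<gamma> 0 = x \<longrightarrow> has_velocity \<gamma> h \<longrightarrow> has_velocity (\<lambda>s. f (\<gamma> s)) (D h))"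

lemma has_hderivD:
  assumes "has_hderiv f x D" "\<gamma> 0 = x" "has_velocity \<gamma> h"
  shows "has_velocity (\<lambda>s. f (\<gamma> s)) (D h)"
  by (rule assms(1)[unfolded has_hderiv_def, THEN spec, THEN spec, THEN mp, THEN mp, OF assms(2,3)])

lemma has_hderiv_imp_dderiv:
  fixes f :: "'a::tvs \<Rightarrow> 'b::{real_vector,t2_space}"
  assumes "has_hderiv f x D"
  shows "dderiv f x h = D h"
proof (rule has_dderiv_imp_dderiv)
  show "has_dderiv f x h (D h)"
    unfolding has_dderiv_iff_has_velocity
    by (rule has_hderivD[OF assms _ has_velocity_line]) simp
qed

lemma has_hderiv_comp:
  assumes "has_hderiv f x D" "has_hderiv g (f x) E"
  shows "has_hderiv (\<lambda>x. g (f x)) x (\<lambda>h. E (D h))"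
  unfolding has_hderiv_def
proof (intro allI impI)
  fix \<gamma> h assume \<gamma>: "\<gamma> 0 = x" "has_velocity \<gamma> h"
  then have "has_velocity (\<lambda>s. f (\<gamma> s)) (D h)"
    by (rule has_hderivD[OF assms(1)])
  with \<gamma>(1) show "has_velocity (\<lambda>s. g (f (\<gamma> s))) (E (D h))"
    by (intro has_hderivD[OF assms(2), of "\<lambda>s. f (\<gamma> s)" "D h"]) simp_all
qed

lemma has_hderiv_cong:
  fixes x :: "'a::tvs"
  assumes "\<forall>\<^sub>F y in nhds x. f y = g y"
  shows "has_hderiv f x D \<longleftrightarrow> has_hderiv g x D"
proof -
  have "has_velocity (\<lambda>s. f (\<gamma> s)) k \<longleftrightarrow> has_velocity (\<lambda>s. g (\<gamma> s)) k"
    if "\<gamma> 0 = x" "has_velocity \<gamma> h" for \<gamma> h k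
  proof (rule has_velocity_cong)
    have "filterlim \<gamma> (nhds x) (nhds 0)"
      using tendsto_at_iff_tendsto_nhds[THEN iffD1, OF has_velocity_imp_tendsto[OF that(2)]] that(1)
      by simp
    then show "\<forall>\<^sub>F s in nhds 0. f (\<gamma> s) = g (\<gamma> s)"
      using assms by (auto simp: filterlim_iff)
  qed
  then show ?thesis
    by (simp add: has_hderiv_def cong: imp_cong)
qed

lemma has_hderiv_ident: "has_hderiv (\<lambda>x. x) x (\<lambda>h. h)"
  by (simp add: has_hderiv_def)

lemma has_hderiv_Pair_left: "has_hderiv (\<lambda>y. (c, y)) x (\<lambda>h. (0::'a::tvs, h))"
  by (simp add: has_hderiv_def has_velocity_Pair has_velocity_const)

lemma has_hderiv_Pair_right: "has_hderiv (\<lambda>y. (y, c)) x (\<lambda>h. (h, 0::'a::tvs))"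
  by (simp add: has_hderiv_def has_velocity_Pair has_velocity_const)

lemma has_hderiv_unique:
  fixes f :: "'a::tvs \<Rightarrow> 'b::{real_vector,t2_space}"
  assumes "has_hderiv f x D" "has_hderiv f x E"
  shows "D = E"
  using has_hderiv_imp_dderiv[OF assms(1)] has_hderiv_imp_dderiv[OF assms(2)] by auto

text \<open>The class \<open>C\<^sup>1\<close> of Michal-Bastiani calculus. A smooth map and its directional derivatives in
  constant directions belong to it, which is all the differentiability used below.\<close>

definition cont_diff_on :: "'a::tvs set \<Rightarrow> ('a \<Rightarrow> 'b::lcs) \<Rightarrow> bool"
  where "cont_diff_on S f \<longleftrightarrow>
    open S \<and> (\<forall>x\<in>S. \<forall>h. has_dderiv f x h (dderiv f x h)) \<and>
    continuous_on (S \<times> UNIV) (\<lambda>(x, h). dderiv f x h)"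

lemma smooth_onD:
  assumes "smooth_on S f"
  shows "open S" and "x \<in> S \<Longrightarrow> \<exists>D. has_dderiv (iter_dderiv f h k) x (h k) D"
    and "continuous_on (S \<times> UNIV) (\<lambda>(x, h). iter_dderiv f h k x)"
  using assms by (simp_all add: smooth_on_def)

lemma smooth_on_imp_cont_diff_on:
  assumes "smooth_on S f"
  shows "cont_diff_on S f"
  unfolding cont_diff_on_def
proof (intro conjI ballI allI)
  show "open S" using assms by (simp add: smooth_on_def)
  show "has_dderiv f x h (dderiv f x h)" if "x \<in> S" for x h
    using smooth_onD(2)[OF assms that, of "\<lambda>_. h" 0] has_dderiv_imp_dderiv by fastforce
  have "continuous_on (S \<times> UNIV) (\<lambda>(x, h). iter_dderiv f h (Suc 0) x)"
    by (rule smooth_onD(3)[OF assms])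
  moreover have "continuous_on (S \<times> UNIV) (\<lambda>z. (fst z, (\<lambda>i::nat. snd z)))"
    by (intro continuous_intros continuous_on_coordinatewise_then_product)
  ultimately have "continuous_on (S \<times> UNIV)
      (\<lambda>z. (\<lambda>(x, h). iter_dderiv f h (Suc 0) x) (fst z, (\<lambda>i::nat. snd z)))"
    by (rule continuous_on_compose2) auto
  then show "continuous_on (S \<times> UNIV) (\<lambda>(x, h). dderiv f x h)"
    by (simp add: case_prod_unfold)
qed

lemma smooth_on_imp_cont_diff_on_dderiv:
  assumes "smooth_on S f"
  shows "cont_diff_on S (\<lambda>x. dderiv f x h)"
  unfolding cont_diff_on_def
proof (intro conjI ballI allI)
  let ?h = "\<lambda>k i. if i = (0::nat) then h else k"
  show "open S" using assms by (simp add: smooth_on_def)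
  show "has_dderiv (\<lambda>x. dderiv f x h) x k (dderiv (\<lambda>x. dderiv f x h) x k)" if x: "x \<in> S" for x k
  proof -
    obtain D where "has_dderiv (\<lambda>x. dderiv f x h) x k D"
      using smooth_onD(2)[OF assms x, of "?h k" 1] by auto
    then show ?thesis
      using has_dderiv_imp_dderiv by fastforce
  qed
  have "continuous_on (S \<times> UNIV) (\<lambda>(x, h). iter_dderiv f h (Suc (Suc 0)) x)"
    by (rule smooth_onD(3)[OF assms])
  moreover have "continuous_on (S \<times> UNIV) (\<lambda>z. (fst z, ?h (snd z)))"
  proof (intro continuous_intros continuous_on_coordinatewise_then_product)
    show "continuous_on (S \<times> UNIV) (\<lambda>z. ?h (snd z) i)" for i
      by (cases "i = 0") (auto intro: continuous_intros)
  qed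
  ultimately have "continuous_on (S \<times> UNIV)
      (\<lambda>z. (\<lambda>(x, h). iter_dderiv f h (Suc (Suc 0)) x) (fst z, ?h (snd z)))"
    by (rule continuous_on_compose2) auto
  then show "continuous_on (S \<times> UNIV) (\<lambda>(x, k). dderiv (\<lambda>x. dderiv f x h) x k)"
    by (simp add: case_prod_unfold)
qed

lemma cont_diff_on_tendsto_dderiv:
  assumes "cont_diff_on S f" "x \<in> S" "(y \<longlongrightarrow> x) F" "(k \<longlongrightarrow> h) F"
  shows "((\<lambda>s. dderiv f (y s) (k s)) \<longlongrightarrow> dderiv f x h) F"
proof -
  have "open S" and cont: "continuous_on (S \<times> UNIV) (\<lambda>(x, h). dderiv f x h)"
    using assms(1) by (auto simp: cont_diff_on_def)
  have "\<forall>\<^sub>F s in F. (y s, k s) \<in> S \<times> UNIV"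
    using topological_tendstoD[OF assms(3) \<open>open S\<close> assms(2)] by simp
  from continuous_on_tendsto_compose[OF cont tendsto_Pair[OF assms(3,4)] _ this]
  show ?thesis using assms(2) by simp
qed

lemma cont_diff_on_has_velocity_line:
  assumes "cont_diff_on S f" "x + t *\<^sub>R h \<in> S"
  shows "has_velocity (\<lambda>s. f (x + (t + s) *\<^sub>R h)) (dderiv f (x + t *\<^sub>R h) h)"
  using assms unfolding cont_diff_on_def has_dderiv_iff_has_velocity
  by (simp add: scaleR_add_left add.assoc[symmetric])

text \<open>The uniform version of the definition of the directional derivative, with moving base point and moving
  direction. The quotient is a mean value of \<open>dderiv f\<close> over the segment from \<open>y s\<close> to
  \<open>y s + s *\<^sub>R k s\<close>, and continuity of \<open>dderiv f\<close> puts all values on the segment close to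
  \<open>dderiv f x h\<close>.\<close>

lemma cont_diff_on_tendsto_quotient:
  assumes f: "cont_diff_on S f" "x \<in> S"
    and y: "(y \<longlongrightarrow> x) (at 0)" and k: "(k \<longlongrightarrow> h) (at 0)"
  shows "((\<lambda>s. (f (y s + s *\<^sub>R k s) - f (y s)) /\<^sub>R s) \<longlongrightarrow> dderiv f x h) (at 0)"
proof (rule topological_tendstoI)
  fix U assume "open U" "dderiv f x h \<in> U"
  then obtain C where C: "open C" "convex C" "dderiv f x h \<in> C" "C \<subseteq> U"
    by (rule lcs_convex_nhd_at)
  \<comment> \<open>the auxiliary parameter \<open>r\<close> runs through the segment from \<open>0\<close> to \<open>s\<close>\<close>
  let ?N = "nhds (0::real) \<times>\<^sub>F (at (0::real))"
  have line: "((\<lambda>z. y (snd z) + fst z *\<^sub>R k (snd z)) \<longlongrightarrow> x + 0 *\<^sub>R h) ?N"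
    by (intro tendsto_add tendsto_scaleR_tvs filterlim_fst
        filterlim_compose[OF y filterlim_snd] filterlim_compose[OF k filterlim_snd])
  have "((\<lambda>z. dderiv f (y (snd z) + fst z *\<^sub>R k (snd z)) (k (snd z))) \<longlongrightarrow> dderiv f x h) ?N"
    using line by (intro cont_diff_on_tendsto_dderiv[OF f] filterlim_compose[OF k filterlim_snd]) simp
  then have "\<forall>\<^sub>F z in ?N. dderiv f (y (snd z) + fst z *\<^sub>R k (snd z)) (k (snd z)) \<in> C"
    by (rule topological_tendstoD) (use C in auto)
  moreover have "\<forall>\<^sub>F z in ?N. y (snd z) + fst z *\<^sub>R k (snd z) \<in> S"
    using f by (intro topological_tendstoD[OF line]) (auto simp: cont_diff_on_def)
  ultimately have "\<forall>\<^sub>F z in ?N. y (snd z) + fst z *\<^sub>R k (snd z) \<in> S \<and>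
      dderiv f (y (snd z) + fst z *\<^sub>R k (snd z)) (k (snd z)) \<in> C"
    by (rule eventually_conj[rotated])
  then obtain P Q where P: "eventually P (nhds 0)" and Q: "eventually Q (at 0)"
    and PQ: "\<And>r s. P r \<Longrightarrow> Q s \<Longrightarrow> y s + r *\<^sub>R k s \<in> S \<and> dderiv f (y s + r *\<^sub>R k s) (k s) \<in> C"
    by (auto simp: eventually_prod_filter)
  obtain e where e: "e > 0" "\<And>r. \<bar>r\<bar> < e \<Longrightarrow> P r"
    using P by (auto simp: eventually_nhds_metric dist_real_def)
  have "\<forall>\<^sub>F s in at (0::real). \<bar>s\<bar> < e"
    using e(1) by (auto simp: eventually_at dist_real_def)
  moreover have "\<forall>\<^sub>F s in at (0::real). s \<noteq> 0"
    by (simp add: eventually_at_filter)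
  ultimately show "\<forall>\<^sub>F s in at 0. (f (y s + s *\<^sub>R k s) - f (y s)) /\<^sub>R s \<in> U"
    using Q
  proof eventually_elim
    case (elim s)
    have P: "P r" if "r \<in> closed_segment 0 s" for r
      using that elim by (intro e(2)) (auto simp: closed_segment_eq_real_ivl split: if_splits)
    have "(f (y s + s *\<^sub>R k s) - f (y s + 0 *\<^sub>R k s)) /\<^sub>R (s - 0) \<in> C"
      using elim P PQ C
      by (intro mean_value_convex[where D = "\<lambda>r. dderiv f (y s + r *\<^sub>R k s) (k s)"
            and f = "\<lambda>r. f (y s + r *\<^sub>R k s)"] cont_diff_on_has_velocity_line[OF f(1)]) auto
    then show ?case
      using C(4) by auto
  qed
qed

lemma cont_diff_on_has_hderiv:
  assumes f: "cont_diff_on S f" "x \<in> S"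
  shows "has_hderiv f x (dderiv f x)"
  unfolding has_hderiv_def
proof (intro allI impI)
  fix \<gamma> h assume \<gamma>: "\<gamma> 0 = x" "has_velocity \<gamma> h"
  have "((\<lambda>s. (f (x + s *\<^sub>R ((\<gamma> s - \<gamma> 0) /\<^sub>R s)) - f x) /\<^sub>R s) \<longlongrightarrow> dderiv f x h) (at 0)"
    using \<gamma>(2) by (intro cont_diff_on_tendsto_quotient[OF f]) (auto simp: has_velocity_def)
  moreover have "\<forall>\<^sub>F s in at 0. (f (x + s *\<^sub>R ((\<gamma> s - \<gamma> 0) /\<^sub>R s)) - f x) /\<^sub>R s = (f (\<gamma> s) - f (\<gamma> 0)) /\<^sub>R s"
    using \<gamma>(1) by (auto simp: eventually_at_filter)
  ultimately show "has_velocity (\<lambda>s. f (\<gamma> s)) (dderiv f x h)"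
    unfolding has_velocity_def by (rule Lim_transform_eventually)
qed

text \<open>For additivity, the step from \<open>x\<close> to \<open>x + s (h + k)\<close> is broken at \<open>x + s h\<close>; the second half
  has a moving base point.\<close>

lemma cont_diff_on_linear_dderiv:
  assumes f: "cont_diff_on S f" "x \<in> S"
  shows "linear (dderiv f x)"
proof
  fix h k
  have "((\<lambda>s. (f ((x + s *\<^sub>R h) + s *\<^sub>R k) - f (x + s *\<^sub>R h)) /\<^sub>R s) \<longlongrightarrow> dderiv f x k) (at 0)"
    using has_velocity_imp_tendsto[OF has_velocity_line[of x h]]
    by (intro cont_diff_on_tendsto_quotient[OF f]) auto
  moreover have "((\<lambda>s. (f (x + s *\<^sub>R h) - f x) /\<^sub>R s) \<longlongrightarrow> dderiv f x h) (at 0)"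
    by (intro cont_diff_on_tendsto_quotient[OF f]) auto
  ultimately have "((\<lambda>s. (f (x + s *\<^sub>R h) - f x) /\<^sub>R s +
      (f ((x + s *\<^sub>R h) + s *\<^sub>R k) - f (x + s *\<^sub>R h)) /\<^sub>R s) \<longlongrightarrow> dderiv f x h + dderiv f x k) (at 0)"
    by (intro tendsto_add)
  then have "has_dderiv f x (h + k) (dderiv f x h + dderiv f x k)"
    unfolding scaleR_add_right[symmetric] has_dderiv_def by (simp add: scaleR_add_right add.assoc)
  then show "dderiv f x (h + k) = dderiv f x h + dderiv f x k"
    by (rule has_dderiv_imp_dderiv)
next
  fix c h
  have "has_velocity (\<lambda>s. f (x + s *\<^sub>R h)) (dderiv f x h)"
    using f by (simp add: cont_diff_on_def has_dderiv_iff_has_velocity)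
  then have "has_velocity (\<lambda>s. f (x + (c * s) *\<^sub>R h)) (c *\<^sub>R dderiv f x h)"
    by (rule has_velocity_scale_time)
  then have "has_dderiv f x (c *\<^sub>R h) (c *\<^sub>R dderiv f x h)"
    by (simp add: has_dderiv_iff_has_velocity mult.commute)
  then show "dderiv f x (c *\<^sub>R h) = c *\<^sub>R dderiv f x h"
    by (rule has_dderiv_imp_dderiv)
qed

lemma cont_diff_on_continuous_dderiv:
  assumes "cont_diff_on S f" "x \<in> S"
  shows "continuous_on UNIV (dderiv f x)"
  unfolding continuous_on_def
  using cont_diff_on_tendsto_dderiv[OF assms tendsto_const tendsto_ident_at] by blast

text \<open>The second difference is a difference in the \<open>h\<close> direction of differences in the \<open>k\<close> direction. Two
  applications of the mean value theorem express it through values of the second derivative near \<open>x\<close>.\<close>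

lemma second_difference_tendsto:
  assumes f: "cont_diff_on S f" and fh: "cont_diff_on S (\<lambda>x. dderiv f x h)" and x: "x \<in> S"
  shows "((\<lambda>s. (f (x + s *\<^sub>R h + s *\<^sub>R k) - f (x + s *\<^sub>R h) - f (x + s *\<^sub>R k) + f x) /\<^sub>R (s * s))
    \<longlongrightarrow> dderiv (\<lambda>x. dderiv f x h) x k) (at 0)"
proof (rule topological_tendstoI)
  let ?fh = "\<lambda>x. dderiv f x h"
  fix U assume "open U" "dderiv ?fh x k \<in> U"
  then obtain C where C: "open C" "convex C" "dderiv ?fh x k \<in> C" "C \<subseteq> U"
    by (rule lcs_convex_nhd_at)
  \<comment> \<open>the rectangle spanned by \<open>s h\<close> and \<open>s k\<close> at \<open>x\<close>\<close>
  let ?N = "nhds (0::real) \<times>\<^sub>F nhds (0::real)"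
  have plane: "((\<lambda>z. x + fst z *\<^sub>R h + snd z *\<^sub>R k) \<longlongrightarrow> x + 0 *\<^sub>R h + 0 *\<^sub>R k) ?N"
    by (intro tendsto_add tendsto_scaleR_tvs filterlim_fst filterlim_snd tendsto_const)
  then have "((\<lambda>z. dderiv ?fh (x + fst z *\<^sub>R h + snd z *\<^sub>R k) k) \<longlongrightarrow> dderiv ?fh x k) ?N"
    by (intro cont_diff_on_tendsto_dderiv[OF fh x] tendsto_const) simp
  then have "\<forall>\<^sub>F z in ?N. dderiv ?fh (x + fst z *\<^sub>R h + snd z *\<^sub>R k) k \<in> C"
    by (rule topological_tendstoD) (use C in auto)
  moreover have "\<forall>\<^sub>F z in ?N. x + fst z *\<^sub>R h + snd z *\<^sub>R k \<in> S"
    using f x by (intro topological_tendstoD[OF plane]) (auto simp: cont_diff_on_def)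
  ultimately have "\<forall>\<^sub>F z in ?N. x + fst z *\<^sub>R h + snd z *\<^sub>R k \<in> S \<and>
      dderiv ?fh (x + fst z *\<^sub>R h + snd z *\<^sub>R k) k \<in> C"
    by (rule eventually_conj[rotated])
  then obtain P Q where P: "eventually P (nhds 0)" and Q: "eventually Q (nhds 0)"
    and PQ: "\<And>r t. P r \<Longrightarrow> Q t \<Longrightarrow> x + r *\<^sub>R h + t *\<^sub>R k \<in> S \<and> dderiv ?fh (x + r *\<^sub>R h + t *\<^sub>R k) k \<in> C"
    by (auto simp: eventually_prod_filter)
  have "\<forall>\<^sub>F s in nhds 0. P s \<and> Q s"
    using P Q by (rule eventually_conj)
  then obtain e where e: "e > 0" "\<And>r. \<bar>r\<bar> < e \<Longrightarrow> P r \<and> Q r"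
    by (auto simp: eventually_nhds_metric dist_real_def)
  have "\<forall>\<^sub>F s in at (0::real). \<bar>s\<bar> < e"
    using e(1) by (auto simp: eventually_at dist_real_def)
  moreover have "\<forall>\<^sub>F s in at (0::real). s \<noteq> 0"
    by (simp add: eventually_at_filter)
  ultimately show "\<forall>\<^sub>F s in at 0. (f (x + s *\<^sub>R h + s *\<^sub>R k) - f (x + s *\<^sub>R h) - f (x + s *\<^sub>R k) + f x)
      /\<^sub>R (s * s) \<in> U"
  proof eventually_elim
    case (elim s)
    have small: "P r \<and> Q r" if "r \<in> closed_segment 0 s" for r
      using that elim by (intro e(2)) (auto simp: closed_segment_eq_real_ivl split: if_splits)
    let ?D = "\<lambda>r. (?fh (x + r *\<^sub>R h + s *\<^sub>R k) - ?fh (x + r *\<^sub>R h)) /\<^sub>R s"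
    let ?g = "\<lambda>r. (f (x + r *\<^sub>R h + s *\<^sub>R k) - f (x + r *\<^sub>R h)) /\<^sub>R s"
    have "?D r \<in> C" if r: "r \<in> closed_segment 0 s" for r
    proof -
      have "(?fh (x + r *\<^sub>R h + s *\<^sub>R k) - ?fh (x + r *\<^sub>R h + 0 *\<^sub>R k)) /\<^sub>R (s - 0) \<in> C"
        using elim small r PQ C
        by (intro mean_value_convex[where D = "\<lambda>t. dderiv ?fh (x + r *\<^sub>R h + t *\<^sub>R k) k"
              and f = "\<lambda>t. ?fh (x + r *\<^sub>R h + t *\<^sub>R k)"] cont_diff_on_has_velocity_line[OF fh]) auto
      then show ?thesis by simp
    qed
    moreover have "has_velocity (\<lambda>t. ?g (r + t)) (?D r)" if r: "r \<in> closed_segment 0 s" for r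
    proof -
      have 1: "x + s *\<^sub>R k + r *\<^sub>R h \<in> S"
        using PQ[of r s] small[OF r] small[of s] by (simp add: add.commute add.left_commute)
      have 2: "x + r *\<^sub>R h \<in> S"
        using PQ[of r 0] small[OF r] small[of 0] by simp
      have "has_velocity (\<lambda>t. (f (x + s *\<^sub>R k + (r + t) *\<^sub>R h) - f (x + (r + t) *\<^sub>R h)) /\<^sub>R s)
          ((?fh (x + s *\<^sub>R k + r *\<^sub>R h) - ?fh (x + r *\<^sub>R h)) /\<^sub>R s)"
      proof (rule has_velocity_linear[of _ _ "\<lambda>v. v /\<^sub>R s"])
        show "has_velocity (\<lambda>t. f (x + s *\<^sub>R k + (r + t) *\<^sub>R h) - f (x + (r + t) *\<^sub>R h))
          (?fh (x + s *\<^sub>R k + r *\<^sub>R h) - ?fh (x + r *\<^sub>R h))"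
          using 1 2 by (intro has_velocity_diff cont_diff_on_has_velocity_line[OF f])
        show "linear (\<lambda>v :: 'b. v /\<^sub>R s)"
          by (auto intro!: linearI simp: scaleR_add_right)
        show "continuous_on UNIV (\<lambda>v :: 'b. v /\<^sub>R s)"
          by (intro continuous_on_scaleR_tvs continuous_on_const continuous_on_id)
      qed
      then show ?thesis
        by (simp only: add.assoc add.commute[of "s *\<^sub>R k"])
    qed
    ultimately have "(?g s - ?g 0) /\<^sub>R (s - 0) \<in> C"
      using elim C by (intro mean_value_convex[where D = ?D and f = ?g]) auto
    moreover have "(?g s - ?g 0) /\<^sub>R (s - 0) =
        (f (x + s *\<^sub>R h + s *\<^sub>R k) - f (x + s *\<^sub>R h) - f (x + s *\<^sub>R k) + f x) /\<^sub>R (s * s)"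
      by (simp add: scaleR_diff_right scaleR_add_right)
    ultimately show ?case
      using C(4) by auto
  qed
qed

text \<open>Schwarz: the second difference is symmetric in \<open>h\<close> and \<open>k\<close>.\<close>

lemma dderiv_commute:
  assumes f: "cont_diff_on S f" and x: "x \<in> S"
    and fh: "cont_diff_on S (\<lambda>x. dderiv f x h)" and fk: "cont_diff_on S (\<lambda>x. dderiv f x k)"
  shows "dderiv (\<lambda>x. dderiv f x h) x k = dderiv (\<lambda>x. dderiv f x k) x h"
proof (rule tendsto_unique)
  show "((\<lambda>s. (f (x + s *\<^sub>R h + s *\<^sub>R k) - f (x + s *\<^sub>R h) - f (x + s *\<^sub>R k) + f x) /\<^sub>R (s * s))
    \<longlongrightarrow> dderiv (\<lambda>x. dderiv f x h) x k) (at 0)"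
    by (rule second_difference_tendsto[OF f fh x])
  show "((\<lambda>s. (f (x + s *\<^sub>R h + s *\<^sub>R k) - f (x + s *\<^sub>R h) - f (x + s *\<^sub>R k) + f x) /\<^sub>R (s * s))
    \<longlongrightarrow> dderiv (\<lambda>x. dderiv f x k) x h) (at 0)"
    using second_difference_tendsto[OF f fk x, of h] by (simp add: algebra_simps)
qed simp

lemma has_dderiv_cong:
  fixes x :: "'a::tvs"
  assumes "open S" "x \<in> S" "\<And>y. y \<in> S \<Longrightarrow> f y = g y"
  shows "has_dderiv f x h D \<longleftrightarrow> has_dderiv g x h D"
  unfolding has_dderiv_iff_has_velocity
proof (rule has_velocity_cong)
  have "((\<lambda>s. x + s *\<^sub>R h) \<longlongrightarrow> x + 0 *\<^sub>R h) (nhds 0)"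
    by (intro tendsto_add tendsto_const tendsto_scaleR_tvs filterlim_ident)
  then have "\<forall>\<^sub>F s in nhds 0. x + s *\<^sub>R h \<in> S"
    by (rule topological_tendstoD) (use assms in auto)
  then show "\<forall>\<^sub>F s in nhds 0. f (x + s *\<^sub>R h) = g (x + s *\<^sub>R h)"
    by eventually_elim (rule assms(3))
qed

lemma dderiv_cong:
  fixes x :: "'a::tvs"
  assumes "open S" "x \<in> S" "\<And>y. y \<in> S \<Longrightarrow> f y = g y"
  shows "dderiv f x h = dderiv g x h"
proof -
  have "has_dderiv f x h D \<longleftrightarrow> has_dderiv g x h D" for D
    by (rule has_dderiv_cong) (use assms in auto)
  then show ?thesis
    unfolding dderiv_def t2_space_class.Lim_def has_dderiv_def by simp
qed

text \<open>The coordinate expressions of smooth maps are composed with inverses chosen by \<^const>\<open>inv_into\<close>; this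
  lemma replaces them by explicit formulas on their domain.\<close>

lemma smooth_on_cong:
  fixes f :: "'a::tvs \<Rightarrow> 'b::{real_vector,t2_space}"
  assumes f: "smooth_on S f" and eq: "\<And>x. x \<in> S \<Longrightarrow> f x = g x"
  shows "smooth_on S g"
proof -
  have "open S" using f by (rule smooth_onD)
  have iter: "iter_dderiv f h k x = iter_dderiv g h k x" if "x \<in> S" for h k x
    using that
  proof (induction k arbitrary: x)
    case 0
    then show ?case by (simp add: eq)
  next
    case (Suc k)
    then show ?case
      using dderiv_cong[OF \<open>open S\<close>, of x "iter_dderiv f h k" "iter_dderiv g h k"] by simp
  qed
  have "has_dderiv (iter_dderiv f h k) x (h k) D \<longleftrightarrow> has_dderiv (iter_dderiv g h k) x (h k) D"
    if "x \<in> S" for h k x D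
    by (rule has_dderiv_cong[OF \<open>open S\<close> that iter])
  moreover have "continuous_on (S \<times> UNIV) (\<lambda>(x, h). iter_dderiv f h k x) \<longleftrightarrow>
      continuous_on (S \<times> UNIV) (\<lambda>(x, h). iter_dderiv g h k x)" for k
    by (rule continuous_on_cong) (auto simp: iter)
  ultimately show ?thesis
    using smooth_onD[OF f] \<open>open S\<close> unfolding smooth_on_def by blast
qed

lemma smooth_on_tendsto:
  assumes f: "smooth_on S f" and x: "x \<in> S" "(u \<longlongrightarrow> x) F"
  shows "((\<lambda>s. f (u s)) \<longlongrightarrow> f x) F"
proof -
  have "continuous_on S (\<lambda>x. (x, \<lambda>_. 0))"
    by (intro continuous_intros)
  then have "continuous_on S (\<lambda>x. (\<lambda>(x, h). iter_dderiv f h 0 x) (x, \<lambda>_. 0))"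
    by (rule continuous_on_compose2[OF smooth_onD(3)[OF f, of 0]]) auto
  then have "continuous_on S f"
    by simp
  then show ?thesis
    by (rule continuous_on_tendsto_compose[OF _ x(2) x(1) topological_tendstoD[OF x(2) smooth_onD(1)[OF f] x(1)]])
qed

lemma has_hderiv_Pair:
  assumes "has_hderiv f x D" "has_hderiv g x E"
  shows "has_hderiv (\<lambda>y. (f y, g y)) x (\<lambda>h. (D h, E h))"
  unfolding has_hderiv_def
proof (intro allI impI)
  fix \<gamma> h assume \<gamma>: "\<gamma> 0 = x" "has_velocity \<gamma> h"
  show "has_velocity (\<lambda>s. (f (\<gamma> s), g (\<gamma> s))) (D h, E h)"
    using has_hderivD[OF assms(1) \<gamma>] has_hderivD[OF assms(2) \<gamma>] by (rule has_velocity_Pair)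
qed

lemma has_hderiv_const: "has_hderiv (\<lambda>_. c) x (\<lambda>_. 0::'a::tvs)"
  by (simp add: has_hderiv_def has_velocity_const)

lemma has_hderiv_linear:
  fixes L :: "'a::tvs \<Rightarrow> 'b::tvs"
  assumes "linear L" "continuous_on UNIV L"
  shows "has_hderiv L x L"
  unfolding has_hderiv_def using has_velocity_linear[OF _ assms] by simp

text \<open>Running through a curve backwards reverses its velocity.\<close>

lemma has_hderiv_uminus:
  fixes f :: "'a::tvs \<Rightarrow> 'b::lcs"
  assumes "has_hderiv f x D"
  shows "D (- h) = - D h"
proof (rule has_velocity_unique)
  have "has_velocity (\<lambda>s. f (x + s *\<^sub>R h)) (D h)"
    by (rule has_hderivD[OF assms _ has_velocity_line]) simp
  from has_velocity_scale_time[OF this, of "-1"]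
  show "has_velocity (\<lambda>s. f (x + s *\<^sub>R (- h))) (- D h)"
    by simp
  show "has_velocity (\<lambda>s. f (x + s *\<^sub>R (- h))) (D (- h))"
    by (rule has_hderivD[OF assms _ has_velocity_line]) simp
qed

lemma linear_Pair_0_left: "linear (\<lambda>h. (0, h))"
  and linear_Pair_0_right: "linear (\<lambda>h. (h, 0))"
  by (auto intro!: linearI)

section \<open>Lie groups in coordinates\<close>

lemma prod_chart_inv:
  assumes "inj_on (snd a) (fst a)" "inj_on (snd b) (fst b)" "p \<in> snd a ` fst a" "q \<in> snd b ` fst b"
  shows "inv_into (fst a \<times> fst b) (map_prod (snd a) (snd b)) (p, q) = (chart_inv a p, chart_inv b q)"
proof (rule inv_into_f_eq)
  show "inj_on (map_prod (snd a) (snd b)) (fst a \<times> fst b)"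
    using assms(1,2) by (rule map_prod_inj_on)
  show "(chart_inv a p, chart_inv b q) \<in> fst a \<times> fst b"
    using assms(3,4) by (simp add: inv_into_into)
  show "map_prod (snd a) (snd b) (chart_inv a p, chart_inv b q) = (p, q)"
    using assms(3,4) by (simp add: f_inv_into_f)
qed

locale Lie_group =
  fixes G :: "('a, 'e::lcs, 'x::lcs) lie_group" (structure)
  assumes lie: "is_lie_group G"

sublocale Lie_group \<subseteq> group G
  using lie by (simp add: is_lie_group_def)

context Lie_group
begin

abbreviation U1 :: "'a set" where "U1 \<equiv> fst (chart1 G)"
abbreviation \<phi> :: "'a \<Rightarrow> 'e" where "\<phi> \<equiv> snd (chart1 G)"
abbreviation \<psi> :: "'e \<Rightarrow> 'a" where "\<psi> \<equiv> chart_inv (chart1 G)"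
abbreviation p0 :: 'e where "p0 \<equiv> base_pt G"

lemma chart1_atlas: "chart1 G \<in> atlas G" and one_in_U1: "\<one> \<in> U1"
  using lie by (simp_all add: is_lie_group_def)

lemma openin_chart: "a \<in> atlas G \<Longrightarrow> openin (gtop G) (fst a)"
  and open_chart_image: "a \<in> atlas G \<Longrightarrow> open (snd a ` fst a)"
  and homeomorphic_chart:
    "a \<in> atlas G \<Longrightarrow> homeomorphic_map (subtopology (gtop G) (fst a)) (top_of_set (snd a ` fst a)) (snd a)"
  using lie by (simp_all add: is_lie_group_def smooth_manifold_def)

lemma topspace_gtop: "topspace (gtop G) = carrier G"
  using lie by (simp add: is_lie_group_def)

lemma chart_subset_carrier: "a \<in> atlas G \<Longrightarrow> fst a \<subseteq> carrier G"
  using openin_subset[OF openin_chart] topspace_gtop by auto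

lemma chart_at:
  assumes "g \<in> carrier G"
  obtains a where "a \<in> atlas G" "g \<in> fst a"
proof -
  have "carrier G = (\<Union>c\<in>atlas G. fst c)"
    using lie topspace_gtop by (simp add: is_lie_group_def smooth_manifold_def)
  then show ?thesis using assms that by auto
qed

lemma inj_on_chart:
  assumes "a \<in> atlas G"
  shows "inj_on (snd a) (fst a)"
proof -
  have "topspace (subtopology (gtop G) (fst a)) = fst a"
    using chart_subset_carrier[OF assms] topspace_gtop by auto
  then show ?thesis
    using homeomorphic_chart[OF assms] by (simp add: homeomorphic_map_def)
qed

lemma chart_inv_chart [simp]: "a \<in> atlas G \<Longrightarrow> x \<in> fst a \<Longrightarrow> chart_inv a (snd a x) = x"
  by (simp add: inj_on_chart)

lemma chart_inv_in_chart: "p \<in> snd a ` fst a \<Longrightarrow> chart_inv a p \<in> fst a"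
  by (rule inv_into_into)

lemma chart_inv_in_carrier: "a \<in> atlas G \<Longrightarrow> p \<in> snd a ` fst a \<Longrightarrow> chart_inv a p \<in> carrier G"
  by (rule subsetD[OF chart_subset_carrier chart_inv_in_chart])

definition mult_dom :: "('a, 'e) chart \<Rightarrow> ('a, 'e) chart \<Rightarrow> ('a, 'e) chart \<Rightarrow> ('e \<times> 'e) set"
  where "mult_dom a b c =
    {(p, q). p \<in> snd a ` fst a \<and> q \<in> snd b ` fst b \<and> chart_inv a p \<otimes> chart_inv b q \<in> fst c}"

definition mult_in :: "('a, 'e) chart \<Rightarrow> ('a, 'e) chart \<Rightarrow> ('a, 'e) chart \<Rightarrow> 'e \<times> 'e \<Rightarrow> 'e"
  where "mult_in a b c = (\<lambda>(p, q). snd c (chart_inv a p \<otimes> chart_inv b q))"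

lemma smooth_on_mult_in:
  assumes abc: "a \<in> atlas G" "b \<in> atlas G" "c \<in> atlas G"
  shows "smooth_on (mult_dom a b c) (mult_in a b c)"
proof -
  let ?ab = "(fst a \<times> fst b, map_prod (snd a) (snd b))"
  let ?f = "\<lambda>(g, h). g \<otimes> h"
  have dom: "map_prod (snd a) (snd b) ` ((fst a \<times> fst b) \<inter> ?f -` fst c) = mult_dom a b c"
    (is "?l = ?r")
  proof
    show "?l \<subseteq> ?r"
      using abc by (auto simp: mult_dom_def)
    show "?r \<subseteq> ?l"
    proof
      fix z assume "z \<in> ?r"
      then obtain p q where z: "z = (p, q)" "p \<in> snd a ` fst a" "q \<in> snd b ` fst b"
          "chart_inv a p \<otimes> chart_inv b q \<in> fst c"
        by (auto simp: mult_dom_def)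
      then have "z = map_prod (snd a) (snd b) (chart_inv a p, chart_inv b q)"
        by (simp add: f_inv_into_f)
      moreover have "(chart_inv a p, chart_inv b q) \<in> (fst a \<times> fst b) \<inter> ?f -` fst c"
        using z by (auto intro: inv_into_into)
      ultimately show "z \<in> ?l" by blast
    qed
  qed
  have sm: "smooth_map (prod_topology (gtop G) (gtop G)) (prod_atlas (atlas G) (atlas G))
      (gtop G) (atlas G) ?f"
    using lie by (simp add: is_lie_group_def)
  have ab: "?ab \<in> prod_atlas (atlas G) (atlas G)"
    using abc unfolding prod_atlas_def by blast
  have "smooth_on (snd ?ab ` (fst ?ab \<inter> ?f -` fst c)) (snd c \<circ> ?f \<circ> chart_inv ?ab)"
    using sm ab abc(3) unfolding smooth_map_def by blast
  then have "smooth_on (mult_dom a b c)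
      (snd c \<circ> ?f \<circ> inv_into (fst a \<times> fst b) (map_prod (snd a) (snd b)))"
    by (simp only: fst_conv snd_conv dom)
  then show ?thesis
    by (rule smooth_on_cong)
       (use abc in \<open>auto simp: mult_dom_def mult_in_def prod_chart_inv inj_on_chart\<close>)
qed

text \<open>Translations are partial maps of the multiplication, which is smooth in charts; the fixed argument enters
  through some chart around it. Besides the derivative, the lemma records that the coordinate expression is defined and
  continuous at the point, which is what composing such maps needs.\<close>

lemma left_translation:
  assumes g: "g \<in> carrier G" and a: "a \<in> atlas G" "x \<in> fst a" and b: "b \<in> atlas G" "g \<otimes> x \<in> fst b"
  obtains D where "linear D" "continuous_on UNIV D"
    "has_hderiv (\<lambda>p. snd b (g \<otimes> chart_inv a p)) (snd a x) D"
    "\<forall>\<^sub>F p in nhds (snd a x). p \<in> snd a ` fst a \<and> g \<otimes> chart_inv a p \<in> fst b"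
    "((\<lambda>p. snd b (g \<otimes> chart_inv a p)) \<longlongrightarrow> snd b (g \<otimes> x)) (nhds (snd a x))"
proof -
  obtain c where c: "c \<in> atlas G" "g \<in> fst c"
    using chart_at[OF g] .
  have cd: "cont_diff_on (mult_dom c a b) (mult_in c a b)"
    by (intro smooth_on_imp_cont_diff_on smooth_on_mult_in a b c)
  have x: "(snd c g, snd a x) \<in> mult_dom c a b"
    using a b c by (auto simp: mult_dom_def)
  have "has_hderiv (\<lambda>p. mult_in c a b (snd c g, p)) (snd a x)
      (\<lambda>h. dderiv (mult_in c a b) (snd c g, snd a x) (0, h))"
    by (rule has_hderiv_comp[OF has_hderiv_Pair_left cont_diff_on_has_hderiv[OF cd x]])
  then have "has_hderiv (\<lambda>p. snd b (g \<otimes> chart_inv a p)) (snd a x)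
      (\<lambda>h. dderiv (mult_in c a b) (snd c g, snd a x) (0, h))"
    using c by (simp add: mult_in_def)
  moreover have "linear (\<lambda>h. dderiv (mult_in c a b) (snd c g, snd a x) (0, h))"
    using linear_compose[OF linear_Pair_0_left cont_diff_on_linear_dderiv[OF cd x]]
    by (simp add: o_def)
  moreover have "continuous_on UNIV (\<lambda>h. dderiv (mult_in c a b) (snd c g, snd a x) (0, h))"
    by (rule continuous_on_compose2[OF cont_diff_on_continuous_dderiv[OF cd x]])
       (auto intro!: continuous_intros)
  moreover have "\<forall>\<^sub>F p in nhds (snd a x). p \<in> snd a ` fst a \<and> g \<otimes> chart_inv a p \<in> fst b"
  proof -
    have "\<forall>\<^sub>F p in nhds (snd a x). (snd c g, p) \<in> mult_dom c a b"
    proof (rule topological_tendstoD)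
      show "((\<lambda>p. (snd c g, p)) \<longlongrightarrow> (snd c g, snd a x)) (nhds (snd a x))"
        by (intro tendsto_Pair tendsto_const filterlim_ident)
    qed (use cd x in \<open>auto simp: cont_diff_on_def\<close>)
    then show ?thesis
      by eventually_elim (use c in \<open>auto simp: mult_dom_def\<close>)
  qed
  moreover have "((\<lambda>p. mult_in c a b (snd c g, p)) \<longlongrightarrow> mult_in c a b (snd c g, snd a x)) (nhds (snd a x))"
    by (intro smooth_on_tendsto[OF smooth_on_mult_in x] a b c tendsto_Pair tendsto_const filterlim_ident)
  then have "((\<lambda>p. snd b (g \<otimes> chart_inv a p)) \<longlongrightarrow> snd b (g \<otimes> x)) (nhds (snd a x))"
    using a c by (simp add: mult_in_def)
  ultimately show ?thesis using that by blast
qed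

lemma right_translation:
  assumes g: "g \<in> carrier G" and a: "a \<in> atlas G" "x \<in> fst a" and b: "b \<in> atlas G" "x \<otimes> g \<in> fst b"
  obtains D where "linear D" "continuous_on UNIV D"
    "has_hderiv (\<lambda>p. snd b (chart_inv a p \<otimes> g)) (snd a x) D"
    "\<forall>\<^sub>F p in nhds (snd a x). p \<in> snd a ` fst a \<and> chart_inv a p \<otimes> g \<in> fst b"
    "((\<lambda>p. snd b (chart_inv a p \<otimes> g)) \<longlongrightarrow> snd b (x \<otimes> g)) (nhds (snd a x))"
proof -
  obtain c where c: "c \<in> atlas G" "g \<in> fst c"
    using chart_at[OF g] .
  have cd: "cont_diff_on (mult_dom a c b) (mult_in a c b)"
    by (intro smooth_on_imp_cont_diff_on smooth_on_mult_in a b c)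
  have x: "(snd a x, snd c g) \<in> mult_dom a c b"
    using a b c by (auto simp: mult_dom_def)
  have "has_hderiv (\<lambda>p. mult_in a c b (p, snd c g)) (snd a x)
      (\<lambda>h. dderiv (mult_in a c b) (snd a x, snd c g) (h, 0))"
    by (rule has_hderiv_comp[OF has_hderiv_Pair_right cont_diff_on_has_hderiv[OF cd x]])
  then have "has_hderiv (\<lambda>p. snd b (chart_inv a p \<otimes> g)) (snd a x)
      (\<lambda>h. dderiv (mult_in a c b) (snd a x, snd c g) (h, 0))"
    using c by (simp add: mult_in_def)
  moreover have "linear (\<lambda>h. dderiv (mult_in a c b) (snd a x, snd c g) (h, 0))"
    using linear_compose[OF linear_Pair_0_right cont_diff_on_linear_dderiv[OF cd x]]
    by (simp add: o_def)
  moreover have "continuous_on UNIV (\<lambda>h. dderiv (mult_in a c b) (snd a x, snd c g) (h, 0))"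
    by (rule continuous_on_compose2[OF cont_diff_on_continuous_dderiv[OF cd x]])
       (auto intro!: continuous_intros)
  moreover have "\<forall>\<^sub>F p in nhds (snd a x). p \<in> snd a ` fst a \<and> chart_inv a p \<otimes> g \<in> fst b"
  proof -
    have "\<forall>\<^sub>F p in nhds (snd a x). (p, snd c g) \<in> mult_dom a c b"
    proof (rule topological_tendstoD)
      show "((\<lambda>p. (p, snd c g)) \<longlongrightarrow> (snd a x, snd c g)) (nhds (snd a x))"
        by (intro tendsto_Pair tendsto_const filterlim_ident)
    qed (use cd x in \<open>auto simp: cont_diff_on_def\<close>)
    then show ?thesis
      by eventually_elim (use c in \<open>auto simp: mult_dom_def\<close>)
  qed
  moreover have "((\<lambda>p. mult_in a c b (p, snd c g)) \<longlongrightarrow> mult_in a c b (snd a x, snd c g)) (nhds (snd a x))"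
    by (intro smooth_on_tendsto[OF smooth_on_mult_in x] a b c tendsto_Pair tendsto_const filterlim_ident)
  then have "((\<lambda>p. snd b (chart_inv a p \<otimes> g)) \<longlongrightarrow> snd b (x \<otimes> g)) (nhds (snd a x))"
    using a c by (simp add: mult_in_def)
  ultimately show ?thesis using that by blast
qed

lemma \<psi>_p0 [simp]: "\<psi> p0 = \<one>"
  by (simp add: base_pt_def chart1_atlas one_in_U1)

lemma p0_in_image: "p0 \<in> \<phi> ` U1"
  by (simp add: base_pt_def one_in_U1)

lemma eventually_in_U1: "\<forall>\<^sub>F p in nhds p0. p \<in> \<phi> ` U1"
  using open_chart_image[OF chart1_atlas] p0_in_image by (simp add: eventually_nhds) blast

lemma \<phi>_\<psi> [simp]: "p \<in> \<phi> ` U1 \<Longrightarrow> \<phi> (\<psi> p) = p"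
  by (rule f_inv_into_f)

lemma \<psi>_in_carrier: "p \<in> \<phi> ` U1 \<Longrightarrow> \<psi> p \<in> carrier G"
  by (rule chart_inv_in_carrier[OF chart1_atlas])

lemma \<psi>_\<phi> [simp]: "g \<in> U1 \<Longrightarrow> \<psi> (\<phi> g) = g"
  by (rule chart_inv_chart[OF chart1_atlas])

text \<open>By left translation it suffices to differentiate at the identity: a straight line through a point \<open>p\<close>
  of any chart becomes, after translation by the inverse of the point, a differentiable curve through
  \<open>\<one>\<close>. Hence \<open>F\<close> has velocity zero along all such lines, is constant on convex parts of charts, and its
  level sets are open.\<close>

lemma constant_if_derivative_zero:
  fixes F :: "'a \<Rightarrow> 'v::lcs"
  assumes conn: "connected_space (gtop G)"
    and zero: "\<And>g. g \<in> carrier G \<Longrightarrow> has_hderiv (\<lambda>p. F (g \<otimes> \<psi> p)) p0 (\<lambda>_. 0)"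
    and g: "g \<in> carrier G"
  shows "F g = F \<one>"
proof -
  have chart_zero: "has_velocity (\<lambda>s. F (chart_inv a (p + s *\<^sub>R h))) 0"
    if a: "a \<in> atlas G" and p: "p \<in> snd a ` fst a" for a p h
  proof -
    let ?g = "chart_inv a p"
    let ?q = "\<lambda>s. inv ?g \<otimes> chart_inv a (p + s *\<^sub>R h)"
    have g: "?g \<in> carrier G" "?g \<in> fst a" "snd a ?g = p"
      using chart_inv_in_carrier[OF a p] chart_inv_in_chart[OF p] p by (simp_all add: f_inv_into_f)
    have "inv ?g \<otimes> ?g \<in> U1"
      using g one_in_U1 by simp
    then obtain D where D: "has_hderiv (\<lambda>p. \<phi> (inv ?g \<otimes> chart_inv a p)) p D"
      "\<forall>\<^sub>F r in nhds p. r \<in> snd a ` fst a \<and> inv ?g \<otimes> chart_inv a r \<in> U1"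
      using left_translation[OF inv_closed[OF g(1)] a g(2) chart1_atlas] g(3) by auto
    have "has_velocity (\<lambda>s. \<phi> (?q s)) (D h)"
      by (rule has_hderivD[OF D(1) _ has_velocity_line]) simp
    moreover have "\<phi> (?q 0) = p0"
      using g by (simp add: base_pt_def)
    ultimately have "has_velocity (\<lambda>s. F (?g \<otimes> \<psi> (\<phi> (?q s)))) 0"
      using has_hderivD[OF zero[OF g(1)]] by fast
    moreover have "\<forall>\<^sub>F s in nhds 0. F (?g \<otimes> \<psi> (\<phi> (?q s))) = F (chart_inv a (p + s *\<^sub>R h))"
    proof -
      have "((\<lambda>s. p + s *\<^sub>R h) \<longlongrightarrow> p + 0 *\<^sub>R h) (nhds 0)"
        by (intro tendsto_add tendsto_const tendsto_scaleR_tvs filterlim_ident)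
      then have "\<forall>\<^sub>F s in nhds 0. p + s *\<^sub>R h \<in> snd a ` fst a \<and> ?q s \<in> U1"
        using D(2) by (auto simp: filterlim_iff)
      then show ?thesis
        by eventually_elim
           (use g chart_inv_in_carrier[OF a] in \<open>simp add: m_assoc[symmetric]\<close>)
    qed
    ultimately show ?thesis
      by (simp add: has_velocity_cong)
  qed
  have loc: "\<exists>N. openin (gtop G) N \<and> x \<in> N \<and> (\<forall>y\<in>N. F y = F x)" if x: "x \<in> carrier G" for x
  proof -
    obtain a where a: "a \<in> atlas G" "x \<in> fst a"
      using chart_at[OF x] .
    have "snd a x \<in> snd a ` fst a"
      using a by simp
    then obtain C where C: "open C" "convex C" "snd a x \<in> C" "C \<subseteq> snd a ` fst a"
      using lcs_convex_nhd_at[OF open_chart_image[OF a(1)]] by blast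
    let ?N = "{y \<in> topspace (subtopology (gtop G) (fst a)). snd a y \<in> C}"
    have "openin (top_of_set (snd a ` fst a)) C"
      using C by (simp add: open_subset)
    then have "openin (subtopology (gtop G) (fst a)) ?N"
      using homeomorphic_imp_continuous_map[OF homeomorphic_chart[OF a(1)]] 
      by (rule openin_continuous_map_preimage[rotated])
    then have "openin (gtop G) ?N"
      using openin_chart[OF a(1)] by (simp add: openin_trans_full)
    moreover have "x \<in> ?N"
      using a C x by (simp add: topspace_gtop)
    moreover have "F y = F x" if y: "y \<in> ?N" for y
    proof -
      have y': "y \<in> fst a" "snd a y \<in> C"
        using y by (auto simp: topspace_gtop)
      let ?p = "\<lambda>t. snd a x + t *\<^sub>R (snd a y - snd a x)"
      have "F (chart_inv a (?p 0)) = F (chart_inv a (?p 1))"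
      proof (rule zero_velocity_imp_const)
        fix t :: real assume "t \<in> closed_segment 0 1"
        then have t: "0 \<le> t" "t \<le> 1" by (auto simp: closed_segment_eq_real_ivl)
        have "(1 - t) *\<^sub>R snd a x + t *\<^sub>R snd a y \<in> C"
          using t C y' by (intro convexD) auto
        then have "?p t \<in> snd a ` fst a"
          using C(4) by (auto simp: algebra_simps)
        from chart_zero[OF a(1) this, of "snd a y - snd a x"]
        show "has_velocity (\<lambda>s. F (chart_inv a (?p (t + s)))) 0"
          by (simp add: scaleR_add_left add.assoc)
      qed
      then show ?thesis
        using a y' by simp
    qed
    ultimately show ?thesis by blast
  qed
  let ?E1 = "{x \<in> carrier G. F x = F \<one>}" and ?E2 = "{x \<in> carrier G. F x \<noteq> F \<one>}"
  have level: "openin (gtop G) {x \<in> carrier G. P (F x)}" for P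
  proof (subst openin_subopen, intro ballI)
    fix x assume x: "x \<in> {x \<in> carrier G. P (F x)}"
    then obtain N where N: "openin (gtop G) N" "x \<in> N" "\<forall>y\<in>N. F y = F x"
      using loc by blast
    moreover have "N \<subseteq> {x \<in> carrier G. P (F x)}"
    proof
      fix y assume "y \<in> N"
      then have "y \<in> carrier G" "F y = F x"
        using N openin_subset[OF N(1)] topspace_gtop by blast+
      then show "y \<in> {x \<in> carrier G. P (F x)}"
        using x by simp
    qed
    ultimately show "\<exists>T. openin (gtop G) T \<and> x \<in> T \<and> T \<subseteq> {x \<in> carrier G. P (F x)}"
      by blast
  qed
  have "openin (gtop G) ?E1" "openin (gtop G) ?E2"
    by (rule level)+
  moreover have "topspace (gtop G) \<subseteq> ?E1 \<union> ?E2" "?E1 \<inter> ?E2 = {}" "?E1 \<noteq> {}"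
    using topspace_gtop one_closed by auto
  ultimately have "?E2 = {}"
    using conn unfolding connected_space_def by blast
  then show ?thesis using g by blast
qed

lemma linear_tangent: "linear (tangent G)"
  using lie by (simp add: is_lie_group_def)

lemma tangent_homeo:
  shows continuous_tangent: "continuous_on UNIV (tangent G)"
    and continuous_from_tangent: "continuous_on UNIV (from_tangent G)"
    and from_tangent_tangent [simp]: "from_tangent G (tangent G X) = X"
    and tangent_from_tangent [simp]: "tangent G (from_tangent G y) = y"
proof -
  have "homeomorphic_map euclidean euclidean (tangent G)"
    using lie by (simp add: is_lie_group_def)
  then obtain g where g: "homeomorphic_maps euclidean euclidean (tangent G) g"
    using homeomorphic_map_maps by blast
  then have inv: "g (tangent G X) = X" "tangent G (g y) = y" for X y
    by (auto simp: homeomorphic_maps_def)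
  have "from_tangent G = g"
    unfolding from_tangent_def by (rule Hilbert_Choice.inv_equality) (simp_all add: inv)
  then show "continuous_on UNIV (tangent G)" "continuous_on UNIV (from_tangent G)"
    "from_tangent G (tangent G X) = X" "tangent G (from_tangent G y) = y"
    using g inv by (auto simp: homeomorphic_maps_def)
qed

lemma linear_from_tangent: "linear (from_tangent G)"
proof
  show "from_tangent G (x + y) = from_tangent G x + from_tangent G y" for x y
    by (metis from_tangent_tangent tangent_from_tangent linear_add[OF linear_tangent])
  show "from_tangent G (r *\<^sub>R x) = r *\<^sub>R from_tangent G x" for r x
    by (metis from_tangent_tangent tangent_from_tangent linear_scale[OF linear_tangent])
qed

section \<open>The adjoint action\<close>

text \<open>The map whose derivative at the base point is, up to \<^const>\<open>tangent\<close>, the operator \<open>Ad g\<close>.\<close>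

definition conj_in :: "'a \<Rightarrow> 'e \<Rightarrow> 'e"
  where "conj_in g p = \<phi> (g \<otimes> \<psi> p \<otimes> inv g)"

lemma conj_in_p0: "g \<in> carrier G \<Longrightarrow> conj_in g p0 = p0"
  by (simp add: conj_in_def base_pt_def[symmetric])

text \<open>For \<open>g\<close> away from the identity, \<open>g \<otimes> \<psi> p\<close> leaves the chart at the identity, so conjugation is a left
  translation into a chart around \<open>g\<close> followed by a right translation back.\<close>

lemma conj_in_derivative:
  assumes g: "g \<in> carrier G"
  obtains D where "linear D" "continuous_on UNIV D" "has_hderiv (conj_in g) p0 D"
    "\<forall>\<^sub>F p in nhds p0. p \<in> \<phi> ` U1 \<and> g \<otimes> \<psi> p \<otimes> inv g \<in> U1"
proof -
  obtain c where c: "c \<in> atlas G" "g \<in> fst c"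
    using chart_at[OF g] .
  have "g \<otimes> \<one> \<in> fst c" "g \<otimes> inv g \<in> U1"
    using c g one_in_U1 by simp_all
  obtain D1 where D1: "linear D1" "continuous_on UNIV D1"
      "has_hderiv (\<lambda>p. snd c (g \<otimes> \<psi> p)) p0 D1"
      "\<forall>\<^sub>F p in nhds p0. p \<in> \<phi> ` U1 \<and> g \<otimes> \<psi> p \<in> fst c"
      "((\<lambda>p. snd c (g \<otimes> \<psi> p)) \<longlongrightarrow> snd c g) (nhds p0)"
    using left_translation[OF g chart1_atlas one_in_U1 c(1) \<open>g \<otimes> \<one> \<in> fst c\<close>] g
    by (auto simp: base_pt_def)
  obtain D2 where D2: "linear D2" "continuous_on UNIV D2"
      "has_hderiv (\<lambda>q. \<phi> (chart_inv c q \<otimes> inv g)) (snd c g) D2"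
      "\<forall>\<^sub>F q in nhds (snd c g). q \<in> snd c ` fst c \<and> chart_inv c q \<otimes> inv g \<in> U1"
    using right_translation[OF inv_closed[OF g] c chart1_atlas \<open>g \<otimes> inv g \<in> U1\<close>] by blast
  have ev: "\<forall>\<^sub>F p in nhds p0. (p \<in> \<phi> ` U1 \<and> g \<otimes> \<psi> p \<in> fst c) \<and>
      chart_inv c (snd c (g \<otimes> \<psi> p)) \<otimes> inv g \<in> U1"
  proof (rule eventually_conj[OF D1(4)])
    have "\<forall>\<^sub>F q in nhds (snd c g). chart_inv c q \<otimes> inv g \<in> U1"
      using D2(4) by eventually_elim simp
    then show "\<forall>\<^sub>F p in nhds p0. chart_inv c (snd c (g \<otimes> \<psi> p)) \<otimes> inv g \<in> U1"
      by (rule eventually_compose_filterlim[OF _ D1(5)])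
  qed
  have "has_hderiv (\<lambda>p. \<phi> (chart_inv c (snd c (g \<otimes> \<psi> p)) \<otimes> inv g)) p0 (\<lambda>h. D2 (D1 h))"
    using has_hderiv_comp[OF D1(3)] D2(3) g by simp
  moreover have "\<forall>\<^sub>F p in nhds p0. \<phi> (chart_inv c (snd c (g \<otimes> \<psi> p)) \<otimes> inv g) = conj_in g p"
    using ev by eventually_elim (use c in \<open>simp add: conj_in_def\<close>)
  ultimately have "has_hderiv (conj_in g) p0 (\<lambda>h. D2 (D1 h))"
    by (simp add: has_hderiv_cong)
  moreover have "linear (\<lambda>h. D2 (D1 h))" "continuous_on UNIV (\<lambda>h. D2 (D1 h))"
    using linear_compose[OF D1(1) D2(1)] continuous_on_compose2[OF D2(2) D1(2)] by (auto simp: o_def)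
  moreover have "\<forall>\<^sub>F p in nhds p0. p \<in> \<phi> ` U1 \<and> g \<otimes> \<psi> p \<otimes> inv g \<in> U1"
    using ev by eventually_elim (use c in auto)
  ultimately show ?thesis using that by blast
qed

lemma conj_in_has_hderiv:
  assumes "g \<in> carrier G"
  shows "has_hderiv (conj_in g) p0 (dderiv (conj_in g) p0)"
    and "linear (dderiv (conj_in g) p0)" and "continuous_on UNIV (dderiv (conj_in g) p0)"
proof -
  obtain D where D: "linear D" "continuous_on UNIV D" "has_hderiv (conj_in g) p0 D"
    using conj_in_derivative[OF assms] by blast
  moreover have "dderiv (conj_in g) p0 = D"
    using has_hderiv_imp_dderiv[OF D(3)] by auto
  ultimately show "has_hderiv (conj_in g) p0 (dderiv (conj_in g) p0)"
    "linear (dderiv (conj_in g) p0)" "continuous_on UNIV (dderiv (conj_in g) p0)"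
    by simp_all
qed

lemma Ad_conj_in: "Ad G g X = from_tangent G (dderiv (conj_in g) p0 (tangent G X))"
  by (simp add: Ad_def conj_in_def[abs_def])

lemma linear_Ad: "g \<in> carrier G \<Longrightarrow> linear (Ad G g)"
  using linear_compose[OF linear_compose[OF linear_tangent conj_in_has_hderiv(2)] linear_from_tangent]
  by (simp add: Ad_conj_in[abs_def] o_def)

lemma continuous_Ad: "g \<in> carrier G \<Longrightarrow> continuous_on UNIV (Ad G g)"
  unfolding Ad_conj_in[abs_def]
  by (rule continuous_on_compose2[OF continuous_from_tangent
        continuous_on_compose2[OF conj_in_has_hderiv(3) continuous_tangent]]) auto

lemma Ad_one: "Ad G \<one> X = X"
proof -
  have "\<forall>\<^sub>F p in nhds p0. p = conj_in \<one> p"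
    using eventually_in_U1 by eventually_elim (simp add: conj_in_def \<psi>_in_carrier)
  from has_hderiv_cong[THEN iffD1, OF this has_hderiv_ident]
  have "has_hderiv (conj_in \<one>) p0 (\<lambda>h. h)" .
  from has_hderiv_imp_dderiv[OF this] show ?thesis
    by (simp add: Ad_conj_in)
qed

lemma Ad_mult:
  assumes g: "g \<in> carrier G" and h: "h \<in> carrier G"
  shows "Ad G (g \<otimes> h) X = Ad G g (Ad G h X)"
proof -
  have "\<forall>\<^sub>F p in nhds p0. p \<in> \<phi> ` U1 \<and> h \<otimes> \<psi> p \<otimes> inv h \<in> U1"
    using conj_in_derivative[OF h] by blast
  then have "\<forall>\<^sub>F p in nhds p0. conj_in g (conj_in h p) = conj_in (g \<otimes> h) p"
  proof eventually_elim
    case (elim p)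
    then have "\<psi> p \<in> carrier G" by (simp add: \<psi>_in_carrier)
    then show ?case
      using elim g h by (simp add: conj_in_def m_assoc inv_mult_group)
  qed
  moreover have "has_hderiv (\<lambda>p. conj_in g (conj_in h p)) p0
      (\<lambda>x. dderiv (conj_in g) p0 (dderiv (conj_in h) p0 x))"
    using has_hderiv_comp[OF conj_in_has_hderiv(1)[OF h]] conj_in_has_hderiv(1)[OF g] h
    by (simp add: conj_in_p0)
  ultimately have "has_hderiv (conj_in (g \<otimes> h)) p0
      (\<lambda>x. dderiv (conj_in g) p0 (dderiv (conj_in h) p0 x))"
    by (simp add: has_hderiv_cong)
  from has_hderiv_imp_dderiv[OF this] show ?thesis
    by (simp add: Ad_conj_in)
qed

lemma inv_Ad:
  assumes "g \<in> carrier G"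
  shows "inv_into UNIV (Ad G g) = Ad G (inv g)"
  by (rule Hilbert_Choice.inv_equality) (use assms in \<open>simp_all add: Ad_mult[symmetric] Ad_one\<close>)

abbreviation mult1 :: "'e \<times> 'e \<Rightarrow> 'e"
  where "mult1 \<equiv> mult_in (chart1 G) (chart1 G) (chart1 G)"

abbreviation dom1 :: "('e \<times> 'e) set"
  where "dom1 \<equiv> mult_dom (chart1 G) (chart1 G) (chart1 G)"

abbreviation inv1 :: "'e \<Rightarrow> 'e"
  where "inv1 p \<equiv> \<phi> (inv (\<psi> p))"

lemma smooth_mult1: "smooth_on dom1 mult1"
  by (intro smooth_on_mult_in chart1_atlas)

lemmas cont_diff_mult1 = smooth_on_imp_cont_diff_on[OF smooth_mult1]

lemma p0_p0_in_dom1: "(p0, p0) \<in> dom1"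
  using p0_in_image one_in_U1 by (simp add: mult_dom_def)

lemma eventually_in_dom1:
  shows "\<forall>\<^sub>F p in nhds p0. (p, p0) \<in> dom1" and "\<forall>\<^sub>F p in nhds p0. (p0, p) \<in> dom1"
  by (rule topological_tendstoD[OF _ smooth_onD(1)[OF smooth_mult1] p0_p0_in_dom1],
      intro tendsto_Pair tendsto_const filterlim_ident)+

lemma mult1_p0:
  assumes "p \<in> \<phi> ` U1"
  shows "mult1 (p, p0) = p" and "mult1 (p0, p) = p"
  using assms by (simp_all add: mult_in_def \<psi>_in_carrier)

lemma dderiv_mult1_p0:
  shows "dderiv mult1 (p0, p0) (h, 0) = h" and "dderiv mult1 (p0, p0) (0, h) = h"
    and "dderiv mult1 (p0, p0) (h, k) = h + k"
proof -
  note D = cont_diff_on_has_hderiv[OF cont_diff_mult1 p0_p0_in_dom1]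
  have "has_hderiv (\<lambda>p. mult1 (p, p0)) p0 (\<lambda>h. dderiv mult1 (p0, p0) (h, 0))"
    by (rule has_hderiv_comp[OF has_hderiv_Pair_right D])
  moreover have "\<forall>\<^sub>F p in nhds p0. mult1 (p, p0) = p"
    using eventually_in_U1 by eventually_elim (rule mult1_p0)
  ultimately have "has_hderiv (\<lambda>p. p) p0 (\<lambda>h. dderiv mult1 (p0, p0) (h, 0))"
    by (simp add: has_hderiv_cong)
  from fun_cong[OF has_hderiv_unique[OF this has_hderiv_ident]]
  show 1: "dderiv mult1 (p0, p0) (h, 0) = h" for h by simp
  have "has_hderiv (\<lambda>p. mult1 (p0, p)) p0 (\<lambda>h. dderiv mult1 (p0, p0) (0, h))"
    by (rule has_hderiv_comp[OF has_hderiv_Pair_left D])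
  moreover have "\<forall>\<^sub>F p in nhds p0. mult1 (p0, p) = p"
    using eventually_in_U1 by eventually_elim (rule mult1_p0)
  ultimately have "has_hderiv (\<lambda>p. p) p0 (\<lambda>h. dderiv mult1 (p0, p0) (0, h))"
    by (simp add: has_hderiv_cong)
  from fun_cong[OF has_hderiv_unique[OF this has_hderiv_ident]]
  show 2: "dderiv mult1 (p0, p0) (0, h) = h" for h by simp
  show "dderiv mult1 (p0, p0) (h, k) = h + k"
    using linear_add[OF cont_diff_on_linear_dderiv[OF cont_diff_mult1 p0_p0_in_dom1], of "(h, 0)" "(0, k)"]
    by (simp add: 1 2)
qed

lemma smooth_on_inv1: "smooth_on {p \<in> \<phi> ` U1. inv (\<psi> p) \<in> U1} inv1"
proof -
  have "smooth_map (gtop G) (atlas G) (gtop G) (atlas G) (\<lambda>g. inv g)"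
    using lie by (simp add: is_lie_group_def)
  then have "smooth_on (\<phi> ` (U1 \<inter> (\<lambda>g. inv g) -` U1)) (\<phi> \<circ> (\<lambda>g. inv g) \<circ> \<psi>)"
    using chart1_atlas unfolding smooth_map_def by blast
  moreover have "\<phi> ` (U1 \<inter> (\<lambda>g. inv g) -` U1) = {p \<in> \<phi> ` U1. inv (\<psi> p) \<in> U1}"
    by auto
  ultimately show ?thesis by (simp add: o_def)
qed

lemma inv1_p0: "inv1 p0 = p0"
  by (simp add: base_pt_def[symmetric])

lemma p0_in_dom_inv1: "p0 \<in> {p \<in> \<phi> ` U1. inv (\<psi> p) \<in> U1}"
  using p0_in_image one_in_U1 by simp

lemma eventually_in_dom_inv1: "\<forall>\<^sub>F p in nhds p0. p \<in> \<phi> ` U1 \<and> inv (\<psi> p) \<in> U1"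
  using eventually_nhds_in_open[OF smooth_onD(1)[OF smooth_on_inv1] p0_in_dom_inv1] by simp

lemma inv1_in_dom1:
  assumes "p \<in> \<phi> ` U1" "inv (\<psi> p) \<in> U1"
  shows "(p, inv1 p) \<in> dom1" and "mult1 (p, inv1 p) = p0"
  using assms one_in_U1 by (simp_all add: mult_dom_def mult_in_def \<psi>_in_carrier base_pt_def)

text \<open>Obtained by differentiating the identity \<open>mult1 (p, inv1 p) = p0\<close>.\<close>

lemma inv1_has_hderiv: "has_hderiv inv1 p0 (\<lambda>h. - h)"
proof -
  have inv: "has_hderiv inv1 p0 (dderiv inv1 p0)"
    by (rule cont_diff_on_has_hderiv[OF smooth_on_imp_cont_diff_on[OF smooth_on_inv1] p0_in_dom_inv1])
  have m: "has_hderiv mult1 (p0, inv1 p0) (dderiv mult1 (p0, p0))"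
    unfolding inv1_p0 by (rule cont_diff_on_has_hderiv[OF cont_diff_mult1 p0_p0_in_dom1])
  have "has_hderiv (\<lambda>p. mult1 (p, inv1 p)) p0 (\<lambda>h. dderiv mult1 (p0, p0) (h, dderiv inv1 p0 h))"
    by (rule has_hderiv_comp[OF has_hderiv_Pair[OF has_hderiv_ident inv] m])
  moreover have "\<forall>\<^sub>F p in nhds p0. mult1 (p, inv1 p) = p0"
    using eventually_in_dom_inv1 by eventually_elim (simp add: inv1_in_dom1)
  ultimately have "has_hderiv (\<lambda>p. p0) p0 (\<lambda>h. dderiv mult1 (p0, p0) (h, dderiv inv1 p0 h))"
    by (simp add: has_hderiv_cong)
  from fun_cong[OF has_hderiv_unique[OF this has_hderiv_const]]
  have "h + dderiv inv1 p0 h = 0" for h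
    by (simp add: dderiv_mult1_p0(3))
  then have "dderiv inv1 p0 = (\<lambda>h. - h)"
    by (metis add_eq_0_iff)
  then show ?thesis using inv by simp
qed

text \<open>Both \<open>A y\<close>, for \<open>A\<close> the derivative of the conjugation, and \<open>y\<close> itself are obtained by applying the
  right translation by the inverse of \<open>\<psi> p\<close>: to the left translate of \<open>y\<close> by \<open>\<psi> p\<close> in the first case,
  to the right translate in the second. Only first derivatives of the multiplication occur. The vanishing difference of the
  translates at \<open>p0\<close> is singled out as the argument of a linear map, so that it can be divided by \<open>s\<close>
  along a curve.\<close>

lemma dderiv_conj_in_diff:
  assumes p: "p \<in> \<phi> ` U1" "inv (\<psi> p) \<in> U1" "(p, p0) \<in> dom1" "(p0, p) \<in> dom1"
  shows "dderiv (conj_in (\<psi> p)) p0 y - y =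
    dderiv mult1 (p, inv1 p) (dderiv mult1 (p, p0) (0, y) - dderiv mult1 (p0, p) (y, 0), 0)"
proof -
  note D = cont_diff_on_has_hderiv[OF cont_diff_mult1]
  note i = inv1_in_dom1[OF p(1,2)]
  have gp: "\<psi> p \<in> carrier G" by (rule \<psi>_in_carrier[OF p(1)])
  have "has_hderiv (\<lambda>q. mult1 (q, inv1 p)) (mult1 (p, p0)) (\<lambda>h. dderiv mult1 (p, inv1 p) (h, 0))"
    unfolding mult1_p0(1)[OF p(1)] by (rule has_hderiv_comp[OF has_hderiv_Pair_right D[OF i(1)]])
  then have "has_hderiv (\<lambda>q. mult1 (mult1 (p, q), inv1 p)) p0
      (\<lambda>y. dderiv mult1 (p, inv1 p) (dderiv mult1 (p, p0) (0, y), 0))"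
    by (rule has_hderiv_comp[OF has_hderiv_comp[OF has_hderiv_Pair_left D[OF p(3)]]])
  moreover have "\<forall>\<^sub>F q in nhds p0. (p, q) \<in> dom1"
    by (rule topological_tendstoD[OF _ smooth_onD(1)[OF smooth_mult1] p(3)])
       (intro tendsto_Pair tendsto_const filterlim_ident)
  then have "\<forall>\<^sub>F q in nhds p0. mult1 (mult1 (p, q), inv1 p) = conj_in (\<psi> p) q"
    by eventually_elim (use p in \<open>auto simp: mult_in_def mult_dom_def conj_in_def\<close>)
  ultimately have "has_hderiv (conj_in (\<psi> p)) p0
      (\<lambda>y. dderiv mult1 (p, inv1 p) (dderiv mult1 (p, p0) (0, y), 0))"
    by (simp add: has_hderiv_cong)
  then have 1: "dderiv (conj_in (\<psi> p)) p0 y =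
      dderiv mult1 (p, inv1 p) (dderiv mult1 (p, p0) (0, y), 0)"
    by (rule has_hderiv_imp_dderiv)
  have "has_hderiv (\<lambda>q. mult1 (q, inv1 p)) (mult1 (p0, p)) (\<lambda>h. dderiv mult1 (p, inv1 p) (h, 0))"
    unfolding mult1_p0(2)[OF p(1)] by (rule has_hderiv_comp[OF has_hderiv_Pair_right D[OF i(1)]])
  then have "has_hderiv (\<lambda>q. mult1 (mult1 (q, p), inv1 p)) p0
      (\<lambda>y. dderiv mult1 (p, inv1 p) (dderiv mult1 (p0, p) (y, 0), 0))"
    by (rule has_hderiv_comp[OF has_hderiv_comp[OF has_hderiv_Pair_right D[OF p(4)]]])
  moreover have "\<forall>\<^sub>F q in nhds p0. (q, p) \<in> dom1"
    by (rule topological_tendstoD[OF _ smooth_onD(1)[OF smooth_mult1] p(4)])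
       (intro tendsto_Pair tendsto_const filterlim_ident)
  then have "\<forall>\<^sub>F q in nhds p0. mult1 (mult1 (q, p), inv1 p) = q"
  proof eventually_elim
    case (elim q)
    then have "q \<in> \<phi> ` U1" "\<psi> q \<otimes> \<psi> p \<in> U1"
      by (auto simp: mult_dom_def)
    then show ?case
      using p(2) gp by (simp add: mult_in_def m_assoc \<psi>_in_carrier)
  qed
  ultimately have "has_hderiv (\<lambda>q. q) p0
      (\<lambda>y. dderiv mult1 (p, inv1 p) (dderiv mult1 (p0, p) (y, 0), 0))"
    by (simp add: has_hderiv_cong)
  from fun_cong[OF has_hderiv_unique[OF this has_hderiv_ident]]
  have 2: "dderiv mult1 (p, inv1 p) (dderiv mult1 (p0, p) (y, 0), 0) = y"
    by simp
  have "dderiv mult1 (p, inv1 p) (dderiv mult1 (p, p0) (0, y), 0) -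
      dderiv mult1 (p, inv1 p) (dderiv mult1 (p0, p) (y, 0), 0) =
    dderiv mult1 (p, inv1 p) (dderiv mult1 (p, p0) (0, y) - dderiv mult1 (p0, p) (y, 0), 0)"
    by (simp add: linear_diff[OF cont_diff_on_linear_dderiv[OF cont_diff_mult1 i(1)], symmetric])
  then show ?thesis
    unfolding 1 2 by simp
qed

lemma left_inv_field_eq:
  assumes "(p, p0) \<in> dom1"
  shows "left_inv_field G X p = dderiv mult1 (p, p0) (0, tangent G X)"
proof -
  have "has_hderiv (\<lambda>q. mult1 (p, q)) p0 (\<lambda>h. dderiv mult1 (p, p0) (0, h))"
    by (rule has_hderiv_comp[OF has_hderiv_Pair_left cont_diff_on_has_hderiv[OF cont_diff_mult1 assms]])
  from has_hderiv_imp_dderiv[OF this] show ?thesis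
    by (simp add: left_inv_field_def mult_in_def)
qed

text \<open>The bracket is the antisymmetrization of the mixed second derivative of the multiplication at the
  identity.\<close>

lemma lie_bracket_eq:
  "lie_bracket G X Y = from_tangent G
    (dderiv (\<lambda>z. dderiv mult1 z (0, tangent G Y)) (p0, p0) (tangent G X, 0) -
     dderiv (\<lambda>z. dderiv mult1 z (0, tangent G X)) (p0, p0) (tangent G Y, 0))"
proof -
  have base: "left_inv_field G X p0 = tangent G X" for X
    by (simp add: left_inv_field_eq[OF p0_p0_in_dom1] dderiv_mult1_p0)
  have "dderiv (left_inv_field G X) p0 h = dderiv (\<lambda>z. dderiv mult1 z (0, tangent G X)) (p0, p0) (h, 0)" for X h
  proof (rule has_hderiv_imp_dderiv)
    have "has_hderiv (\<lambda>p. dderiv mult1 (p, p0) (0, tangent G X)) p0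
        (\<lambda>h. dderiv (\<lambda>z. dderiv mult1 z (0, tangent G X)) (p0, p0) (h, 0))"
      by (rule has_hderiv_comp[OF has_hderiv_Pair_right
            cont_diff_on_has_hderiv[OF smooth_on_imp_cont_diff_on_dderiv[OF smooth_mult1] p0_p0_in_dom1]])
    moreover have "\<forall>\<^sub>F p in nhds p0. dderiv mult1 (p, p0) (0, tangent G X) = left_inv_field G X p"
      using eventually_in_dom1(1) by eventually_elim (simp add: left_inv_field_eq)
    ultimately show "has_hderiv (left_inv_field G X) p0
        (\<lambda>h. dderiv (\<lambda>z. dderiv mult1 z (0, tangent G X)) (p0, p0) (h, 0))"
      by (simp add: has_hderiv_cong)
  qed
  then show ?thesis
    by (simp add: lie_bracket_def base)
qed

text \<open>The derivative of \<open>Ad\<close> at the identity is the adjoint representation of the Lie algebra. By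
  \<open>dderiv_conj_in_diff\<close>, the difference quotient of \<open>Ad\<close> is asymptotically that of left minus right translation.
  The derivative of that difference consists of two mixed second derivatives of the multiplication, taken in
  opposite orders, and Schwarz turns the second one into the second term of the bracket.\<close>

lemma Ad_has_hderiv:
  "has_hderiv (\<lambda>p. Ad G (\<psi> p) Y) p0 (\<lambda>x. lie_bracket G (from_tangent G x) Y)"
  unfolding has_hderiv_def
proof (intro allI impI)
  fix \<gamma> x assume \<gamma>: "\<gamma> 0 = p0" "has_velocity \<gamma> x"
  let ?y = "tangent G Y"
  let ?L = "\<lambda>p. dderiv mult1 (p, p0) (0, ?y)" and ?R = "\<lambda>p. dderiv mult1 (p0, p) (?y, 0)"
  let ?l = "dderiv (\<lambda>z. dderiv mult1 z (0, ?y)) (p0, p0) (x, 0)"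
  let ?r = "dderiv (\<lambda>z. dderiv mult1 z (?y, 0)) (p0, p0) (0, x)"
  note second = cont_diff_on_has_hderiv[OF smooth_on_imp_cont_diff_on_dderiv[OF smooth_mult1] p0_p0_in_dom1]
  have "has_velocity (\<lambda>s. ?L (\<gamma> s)) ?l" "has_velocity (\<lambda>s. ?R (\<gamma> s)) ?r"
    using has_hderivD[OF has_hderiv_comp[OF has_hderiv_Pair_right second] \<gamma>]
      has_hderivD[OF has_hderiv_comp[OF has_hderiv_Pair_left second] \<gamma>] by blast+
  then have "has_velocity (\<lambda>s. ?L (\<gamma> s) - ?R (\<gamma> s)) (?l - ?r)"
    by (rule has_velocity_diff)
  then have LR: "((\<lambda>s. (?L (\<gamma> s) - ?R (\<gamma> s)) /\<^sub>R s) \<longlongrightarrow> ?l - ?r) (at 0)"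
    by (simp add: has_velocity_def \<gamma>(1) dderiv_mult1_p0)
  have \<gamma>_tendsto: "filterlim \<gamma> (nhds p0) (at 0)"
    using has_velocity_imp_tendsto[OF \<gamma>(2)] \<gamma>(1) by simp
  have inv_tendsto: "((\<lambda>s. inv1 (\<gamma> s)) \<longlongrightarrow> p0) (at 0)"
    using has_velocity_imp_tendsto[OF has_hderivD[OF inv1_has_hderiv \<gamma>]] \<gamma>(1) inv1_p0 by simp
  have "((\<lambda>s. dderiv mult1 (\<gamma> s, inv1 (\<gamma> s)) ((?L (\<gamma> s) - ?R (\<gamma> s)) /\<^sub>R s, 0)) \<longlongrightarrow>
      dderiv mult1 (p0, p0) (?l - ?r, 0)) (at 0)"
    by (intro cont_diff_on_tendsto_dderiv[OF cont_diff_mult1 p0_p0_in_dom1] tendsto_Pair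
        \<gamma>_tendsto inv_tendsto LR tendsto_const)
  moreover have "\<forall>\<^sub>F s in at 0. dderiv mult1 (\<gamma> s, inv1 (\<gamma> s)) ((?L (\<gamma> s) - ?R (\<gamma> s)) /\<^sub>R s, 0) =
      (dderiv (conj_in (\<psi> (\<gamma> s))) p0 ?y - dderiv (conj_in (\<psi> (\<gamma> 0))) p0 ?y) /\<^sub>R s"
  proof -
    have y: "dderiv (conj_in (\<psi> (\<gamma> 0))) p0 ?y = ?y"
      using dderiv_conj_in_diff[OF p0_in_image, of ?y] p0_p0_in_dom1 p0_in_dom_inv1 \<gamma>(1)
      by (simp add: dderiv_mult1_p0 base_pt_def[symmetric])
    have "\<forall>\<^sub>F p in nhds p0. (p \<in> \<phi> ` U1 \<and> inv (\<psi> p) \<in> U1) \<and> (p, p0) \<in> dom1 \<and> (p0, p) \<in> dom1"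
      by (intro eventually_conj eventually_in_dom_inv1 eventually_in_dom1)
    then have "\<forall>\<^sub>F s in at 0. (\<gamma> s \<in> \<phi> ` U1 \<and> inv (\<psi> (\<gamma> s)) \<in> U1) \<and> (\<gamma> s, p0) \<in> dom1 \<and> (p0, \<gamma> s) \<in> dom1"
      by (rule eventually_compose_filterlim[OF _ \<gamma>_tendsto])
    then show ?thesis
    proof eventually_elim
      case (elim s)
      then have "(\<gamma> s, inv1 (\<gamma> s)) \<in> dom1"
        by (simp add: inv1_in_dom1)
      from linear_scale[OF cont_diff_on_linear_dderiv[OF cont_diff_mult1 this],
          of "inverse s" "(?L (\<gamma> s) - ?R (\<gamma> s), 0)"]
      have "dderiv mult1 (\<gamma> s, inv1 (\<gamma> s)) ((?L (\<gamma> s) - ?R (\<gamma> s)) /\<^sub>R s, 0) =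
          dderiv mult1 (\<gamma> s, inv1 (\<gamma> s)) (?L (\<gamma> s) - ?R (\<gamma> s), 0) /\<^sub>R s"
        by simp
      also have "\<dots> = (dderiv (conj_in (\<psi> (\<gamma> s))) p0 ?y - ?y) /\<^sub>R s"
        using elim by (simp add: dderiv_conj_in_diff)
      finally show ?case
        by (simp only: y)
    qed
  qed
  ultimately have "has_velocity (\<lambda>s. dderiv (conj_in (\<psi> (\<gamma> s))) p0 ?y) (dderiv mult1 (p0, p0) (?l - ?r, 0))"
    unfolding has_velocity_def by (rule Lim_transform_eventually)
  then have "has_velocity (\<lambda>s. dderiv (conj_in (\<psi> (\<gamma> s))) p0 ?y) (?l - ?r)"
    by (simp only: dderiv_mult1_p0(1))
  from has_velocity_linear[OF this linear_from_tangent continuous_from_tangent]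
  have "has_velocity (\<lambda>s. Ad G (\<psi> (\<gamma> s)) Y) (from_tangent G (?l - ?r))"
    by (simp add: Ad_conj_in)
  moreover have "?r = dderiv (\<lambda>z. dderiv mult1 z (0, x)) (p0, p0) (?y, 0)"
    by (rule dderiv_commute[OF cont_diff_mult1 p0_p0_in_dom1])
       (intro smooth_on_imp_cont_diff_on_dderiv[OF smooth_mult1])+
  ultimately show "has_velocity (\<lambda>s. Ad G (\<psi> (\<gamma> s)) Y) (lie_bracket G (from_tangent G x) Y)"
    by (simp add: lie_bracket_eq)
qed

end

lemma (in Lie_group) lie_bracket_minus_left: "lie_bracket G (- X) Y = - lie_bracket G X Y"
  using has_hderiv_uminus[OF Ad_has_hderiv, of "tangent G X" Y]
  by (simp add: linear_neg[OF linear_from_tangent])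

section \<open>Smooth linear actions\<close>

locale Lie_group_action = Lie_group G
  for G :: "('a, 'e::lcs, 'x::lcs) lie_group" (structure) +
  fixes \<rho> :: "'a \<Rightarrow> 'v::lcs \<Rightarrow> 'v"
  assumes action: "smooth_linear_action G \<rho>"
begin

lemma linear_\<rho>: "g \<in> carrier G \<Longrightarrow> linear (\<rho> g)"
  and \<rho>_one [simp]: "\<rho> \<one> v = v"
  and \<rho>_mult: "g \<in> carrier G \<Longrightarrow> h \<in> carrier G \<Longrightarrow> \<rho> (g \<otimes> h) v = \<rho> g (\<rho> h v)"
  using action by (simp_all add: smooth_linear_action_def)

lemma smooth_action: "smooth_map (prod_topology (gtop G) euclidean) (prod_atlas (atlas G) vs_atlas)
      euclidean vs_atlas (\<lambda>(g, v). \<rho> g v)"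
  using action by (simp add: smooth_linear_action_def)

lemma continuous_\<rho>:
  assumes "g \<in> carrier G"
  shows "continuous_on UNIV (\<rho> g)"
proof -
  have "continuous_map euclidean (prod_topology (gtop G) euclidean) (\<lambda>v. (g, v))"
    using assms by (simp add: continuous_map_pairedI topspace_gtop)
  from continuous_map_compose[OF this] smooth_action
  have "continuous_map euclidean euclidean ((\<lambda>(g, v). \<rho> g v) \<circ> (\<lambda>v. (g, v)))"
    unfolding smooth_map_def by blast
  then show ?thesis by (simp add: o_def)
qed

lemma smooth_on_action: "smooth_on (\<phi> ` U1 \<times> UNIV) (\<lambda>(p, v). \<rho> (\<psi> p) v)"
proof -
  let ?c = "(U1 \<times> UNIV, map_prod \<phi> id) :: ('a \<times> 'v, 'e \<times> 'v) chart"
  let ?d = "(UNIV, id) :: ('v, 'v) chart"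
  have "?c \<in> prod_atlas (atlas G) vs_atlas"
    using chart1_atlas unfolding prod_atlas_def vs_atlas_def by fastforce
  then have "smooth_on (snd ?c ` (fst ?c \<inter> (\<lambda>(g, v). \<rho> g v) -` fst ?d))
      (snd ?d \<circ> (\<lambda>(g, v). \<rho> g v) \<circ> chart_inv ?c)"
    using smooth_action unfolding smooth_map_def vs_atlas_def by blast
  moreover have "snd ?c ` (fst ?c \<inter> (\<lambda>(g, v). \<rho> g v) -` fst ?d) = \<phi> ` U1 \<times> UNIV"
    by (force simp: image_iff)
  ultimately have "smooth_on (\<phi> ` U1 \<times> UNIV) ((\<lambda>(g, v). \<rho> g v) \<circ> chart_inv ?c)"
    by simp
  then show ?thesis
  proof (rule smooth_on_cong)
    fix z :: "'e \<times> 'v" assume "z \<in> \<phi> ` U1 \<times> UNIV"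
    then obtain p v where z: "z = (p, v)" "p \<in> \<phi> ` U1" by auto
    then have "chart_inv ?c z = (\<psi> p, v)"
      using prod_chart_inv[of "chart1 G" ?d p v] inj_on_chart[OF chart1_atlas]
      by simp
    then show "((\<lambda>(g, v). \<rho> g v) \<circ> chart_inv ?c) z = (\<lambda>(p, v). \<rho> (\<psi> p) v) z"
      by (simp add: z)
  qed
qed

text \<open>The partial derivative in the group direction is the derived action by definition; in the direction of
  the linear variable the map is \<open>\<rho> \<one>\<close>, the identity.\<close>

lemma action_has_hderiv:
  "has_hderiv (\<lambda>(p, v). \<rho> (\<psi> p) v) (p0, v)
    (\<lambda>(x, w). derived_action G \<rho> (from_tangent G x) v + w)"
proof -
  let ?P = "\<lambda>(p, v). \<rho> (\<psi> p) v"
  have cd: "cont_diff_on (\<phi> ` U1 \<times> UNIV) ?P"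
    by (rule smooth_on_imp_cont_diff_on[OF smooth_on_action])
  have z: "(p0, v) \<in> \<phi> ` U1 \<times> UNIV"
    using p0_in_image by simp
  note D = cont_diff_on_has_hderiv[OF cd z]
  have 1: "dderiv ?P (p0, v) (x, 0) = derived_action G \<rho> (from_tangent G x) v" for x
    using has_hderiv_imp_dderiv[OF has_hderiv_comp[OF has_hderiv_Pair_right D], of x]
    by (simp add: derived_action_def)
  have 2: "dderiv ?P (p0, v) (0, w) = w" for w
    using fun_cong[OF has_hderiv_unique[OF has_hderiv_comp[OF has_hderiv_Pair_left D], of "\<lambda>w. w"]]
    by (simp add: has_hderiv_ident)
  have "dderiv ?P (p0, v) (x, w) = derived_action G \<rho> (from_tangent G x) v + w" for x w
    using linear_add[OF cont_diff_on_linear_dderiv[OF cd z], of "(x, 0)" "(0, w)"]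
    by (simp add: 1 2)
  then have "dderiv ?P (p0, v) = (\<lambda>(x, w). derived_action G \<rho> (from_tangent G x) v + w)"
    by auto
  with D show ?thesis by simp
qed

text \<open>The derivative of \<open>h \<mapsto> \<rho> h w\<close> at \<open>h\<close> is \<open>\<rho> h\<close> applied to the derived action on \<open>w\<close>.\<close>

lemma \<rho>_eq_id_if_derived_action_zero:
  assumes conn: "connected_space (gtop G)" and w: "\<And>X. derived_action G \<rho> X w = 0"
    and g: "g \<in> carrier G"
  shows "\<rho> g w = w"
proof -
  have "has_hderiv (\<lambda>p. \<rho> (h \<otimes> \<psi> p) w) p0 (\<lambda>_. 0)" if h: "h \<in> carrier G" for h
  proof -
    have "has_hderiv (\<lambda>p. \<rho> (\<psi> p) w) p0 (\<lambda>x. 0)"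
      using has_hderiv_comp[OF has_hderiv_Pair_right action_has_hderiv, of w] by (simp add: w)
    from has_hderiv_comp[OF this has_hderiv_linear[OF linear_\<rho> continuous_\<rho>, OF h h]]
    have "has_hderiv (\<lambda>p. \<rho> h (\<rho> (\<psi> p) w)) p0 (\<lambda>_. 0)"
      by (simp add: linear_0[OF linear_\<rho>[OF h]])
    moreover have "\<forall>\<^sub>F p in nhds p0. \<rho> h (\<rho> (\<psi> p) w) = \<rho> (h \<otimes> \<psi> p) w"
      using eventually_in_U1 by eventually_elim (simp add: \<rho>_mult h \<psi>_in_carrier)
    ultimately show ?thesis by (simp add: has_hderiv_cong)
  qed
  from constant_if_derivative_zero[where F = "\<lambda>g. \<rho> g w", OF conn this g] show ?thesis
    by simp
qed

lemma C1_action_eq: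
  assumes "g \<in> carrier G"
  shows "C1_action G \<rho> g c = (\<lambda>Y. \<rho> g (c (Ad G (inv g) Y)))"
  by (simp add: C1_action_def inv_Ad[OF assms])

lemma C1_action_mult:
  assumes "g \<in> carrier G" "h \<in> carrier G"
  shows "C1_action G \<rho> (g \<otimes> h) c = C1_action G \<rho> g (C1_action G \<rho> h c)"
  using assms by (simp add: C1_action_eq \<rho>_mult Ad_mult inv_mult_group)

lemma C1_action_one: "C1_action G \<rho> \<one> c = c"
  by (simp add: C1_action_eq Ad_one)

lemma C1_action_add:
  assumes "g \<in> carrier G"
  shows "C1_action G \<rho> g (\<lambda>Y. c Y + d Y) Z = C1_action G \<rho> g c Z + C1_action G \<rho> g d Z"
  by (simp add: C1_action_eq[OF assms] linear_add[OF linear_\<rho>[OF assms]])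

lemma C1_action_diff:
  assumes "g \<in> carrier G"
  shows "C1_action G \<rho> g (\<lambda>Y. c Y - d Y) Z = C1_action G \<rho> g c Z - C1_action G \<rho> g d Z"
  by (simp add: C1_action_eq[OF assms] linear_diff[OF linear_\<rho>[OF assms]])

text \<open>At \<open>g = \<one>\<close> this is the product rule for \<open>p \<mapsto> \<rho> (\<psi> p) (J (Ad (\<psi> p)\<inverse> Y))\<close>. The general case
  follows because \<open>g\<close> acts as a continuous linear operator and \<open>(g \<otimes> h).J = g.(h.J)\<close>.\<close>

lemma C1_action_has_hderiv:
  assumes J: "linear J" "continuous_on UNIV J" and g: "g \<in> carrier G"
  shows "has_hderiv (\<lambda>p. C1_action G \<rho> (g \<otimes> \<psi> p) J Y) p0
    (\<lambda>x. C1_action G \<rho> g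
      (\<lambda>Z. derived_action G \<rho> (from_tangent G x) (J Z) - J (lie_bracket G (from_tangent G x) Z)) Y)"
proof -
  let ?Z = "Ad G (inv g) Y"
  have "has_hderiv (\<lambda>p. Ad G (\<psi> p) ?Z) (inv1 p0) (\<lambda>x. lie_bracket G (from_tangent G x) ?Z)"
    unfolding inv1_p0 by (rule Ad_has_hderiv)
  from has_hderiv_comp[OF has_hderiv_comp[OF inv1_has_hderiv this] has_hderiv_linear[OF J]]
  have "has_hderiv (\<lambda>p. J (Ad G (\<psi> (inv1 p)) ?Z)) p0
      (\<lambda>x. - J (lie_bracket G (from_tangent G x) ?Z))"
    by (simp add: linear_neg[OF linear_from_tangent] lie_bracket_minus_left linear_neg[OF J(1)])
  from has_hderiv_Pair[OF has_hderiv_ident this]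
  have pair: "has_hderiv (\<lambda>p. (p, J (Ad G (\<psi> (inv1 p)) ?Z))) p0
      (\<lambda>x. (x, - J (lie_bracket G (from_tangent G x) ?Z)))" .
  have "has_hderiv (\<lambda>(p, v). \<rho> (\<psi> p) v) (p0, J (Ad G (\<psi> (inv1 p0)) ?Z))
    (\<lambda>(x, w). derived_action G \<rho> (from_tangent G x) (J ?Z) + w)"
    unfolding inv1_p0 by (simp add: Ad_one action_has_hderiv)
  from has_hderiv_comp[OF has_hderiv_comp[OF pair this] has_hderiv_linear[OF linear_\<rho> continuous_\<rho>, OF g g]]
  have "has_hderiv (\<lambda>p. \<rho> g (\<rho> (\<psi> p) (J (Ad G (\<psi> (inv1 p)) ?Z)))) p0
      (\<lambda>x. \<rho> g (derived_action G \<rho> (from_tangent G x) (J ?Z) - J (lie_bracket G (from_tangent G x) ?Z)))"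
    by simp
  moreover have "\<forall>\<^sub>F p in nhds p0. \<rho> g (\<rho> (\<psi> p) (J (Ad G (\<psi> (inv1 p)) ?Z))) =
      C1_action G \<rho> (g \<otimes> \<psi> p) J Y"
    using eventually_in_dom_inv1
    by eventually_elim (simp add: C1_action_eq \<rho>_mult Ad_mult inv_mult_group g \<psi>_in_carrier)
  ultimately show ?thesis
    by (simp add: has_hderiv_cong C1_action_eq[OF g])
qed

section \<open>Group cohomology in degree one\<close>

lemma coboundary_eq_one_iff_equivariant:
  "coboundary G \<rho> c = \<one>\<^bsub>Z1 G \<rho> W\<^esub> \<longleftrightarrow> equivariant G \<rho> c"
proof
  assume eq: "coboundary G \<rho> c = \<one>\<^bsub>Z1 G \<rho> W\<^esub>"
  have "c (Ad G g X) = \<rho> g (c X)" if g: "g \<in> carrier G" for g X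
  proof -
    have "coboundary G \<rho> c g (Ad G g X) = 0"
      using g by (simp add: eq Z1_def)
    then show ?thesis
      using g by (simp add: coboundary_def C1_action_eq Ad_mult[symmetric] Ad_one)
  qed
  then show "equivariant G \<rho> c" by (simp add: equivariant_def)
next
  assume eq: "equivariant G \<rho> c"
  have "C1_action G \<rho> g c Y = c Y" if g: "g \<in> carrier G" for g Y
  proof -
    have "c (Ad G g (Ad G (inv g) Y)) = \<rho> g (c (Ad G (inv g) Y))"
      using eq g by (simp add: equivariant_def)
    then show ?thesis
      using g by (simp add: C1_action_eq Ad_mult[symmetric] Ad_one)
  qed
  then show "coboundary G \<rho> c = \<one>\<^bsub>Z1 G \<rho> W\<^esub>"
    by (auto simp: coboundary_def Z1_def fun_eq_iff)
qed

lemma coboundary_add: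
  "coboundary G \<rho> (\<lambda>Y. c Y + d Y) = coboundary G \<rho> c \<otimes>\<^bsub>Z1 G \<rho> W\<^esub> coboundary G \<rho> d"
  by (auto simp: coboundary_def Z1_def fun_eq_iff C1_action_add)

text \<open>The cocycle identity is formal, and the membership of the values in \<open>C1 W\<close> is the actual
  condition. This is how a momentum map, whose values are in general not \<open>\<hh>\<close>-invariant, yields a
  cocycle.\<close>

lemma coboundary_cocycle:
  assumes "\<And>g. g \<in> carrier G \<Longrightarrow> (\<lambda>Y. C1_action G \<rho> g c Y - c Y) \<in> C1 W"
  shows "coboundary G \<rho> c \<in> carrier (Z1 G \<rho> W)"
  using assms
  by (auto simp: Z1_def coboundary_def C1_action_mult C1_action_diff fun_eq_iff)

end

lemma C1_add: "subspace W \<Longrightarrow> c \<in> C1 W \<Longrightarrow> d \<in> C1 W \<Longrightarrow> (\<lambda>Y. c Y + d Y) \<in> C1 W"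
  by (auto simp: C1_def intro!: linear_compose_add continuous_on_add subspace_add)

lemma C1_minus: "subspace W \<Longrightarrow> c \<in> C1 W \<Longrightarrow> (\<lambda>Y. - c Y) \<in> C1 W"
  by (auto simp: C1_def intro!: linear_compose_neg continuous_on_minus subspace_neg)

lemma C1_diff: "subspace W \<Longrightarrow> c \<in> C1 W \<Longrightarrow> d \<in> C1 W \<Longrightarrow> (\<lambda>Y. c Y - d Y) \<in> C1 W"
  using C1_add[OF _ _ C1_minus, of W c d] by simp

lemma C1_zero: "subspace W \<Longrightarrow> (\<lambda>_. 0) \<in> C1 W"
  by (auto simp: C1_def intro: linearI subspace_0)

locale invariant_subspace = Lie_group_action G \<rho>
  for G :: "('a, 'e::lcs, 'x::lcs) lie_group" (structure) and \<rho> :: "'a \<Rightarrow> 'v::lcs \<Rightarrow> 'v" +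
  fixes W :: "'v set"
  assumes subspace_W: "subspace W"
    and \<rho>_W: "g \<in> carrier G \<Longrightarrow> w \<in> W \<Longrightarrow> \<rho> g w \<in> W"
begin

lemma C1_action_C1:
  assumes g: "g \<in> carrier G" and c: "c \<in> C1 W"
  shows "C1_action G \<rho> g c \<in> C1 W"
proof -
  have c': "linear c" "continuous_on UNIV c" "\<And>Y. c Y \<in> W"
    using c by (auto simp: C1_def)
  have "linear (\<lambda>Y. \<rho> g (c (Ad G (inv g) Y)))"
    using linear_compose[OF linear_compose[OF linear_Ad[OF inv_closed[OF g]] c'(1)] linear_\<rho>[OF g]]
    by (simp add: o_def)
  moreover have "continuous_on UNIV (\<lambda>Y. \<rho> g (c (Ad G (inv g) Y)))"
    by (rule continuous_on_compose2[OF continuous_\<rho>[OF g]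
          continuous_on_compose2[OF c'(2) continuous_Ad[OF inv_closed[OF g]]]]) auto
  ultimately show ?thesis
    using c' g by (auto simp: C1_def C1_action_eq \<rho>_W)
qed

lemma Z1_D:
  assumes "f \<in> carrier (Z1 G \<rho> W)"
  shows "g \<in> carrier G \<Longrightarrow> f g \<in> C1 W" and "f \<in> extensional (carrier G)"
    and "g \<in> carrier G \<Longrightarrow> h \<in> carrier G \<Longrightarrow> f (g \<otimes> h) = (\<lambda>Y. f g Y + C1_action G \<rho> g (f h) Y)"
  using assms by (auto simp: Z1_def PiE_def)

lemma Z1_comm_group: "comm_group (Z1 G \<rho> W)"
proof (rule comm_groupI)
  fix f f' assume f: "f \<in> carrier (Z1 G \<rho> W)" and f': "f' \<in> carrier (Z1 G \<rho> W)"
  show "f \<otimes>\<^bsub>Z1 G \<rho> W\<^esub> f' \<in> carrier (Z1 G \<rho> W)"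
    using Z1_D[OF f] Z1_D[OF f']
    by (auto simp: Z1_def C1_action_add intro!: C1_add subspace_W)
  show "f \<otimes>\<^bsub>Z1 G \<rho> W\<^esub> f' = f' \<otimes>\<^bsub>Z1 G \<rho> W\<^esub> f"
    by (simp add: Z1_def add.commute)
next
  fix f f' f'' assume "f \<in> carrier (Z1 G \<rho> W)"
  show "f \<otimes>\<^bsub>Z1 G \<rho> W\<^esub> f' \<otimes>\<^bsub>Z1 G \<rho> W\<^esub> f'' = f \<otimes>\<^bsub>Z1 G \<rho> W\<^esub> (f' \<otimes>\<^bsub>Z1 G \<rho> W\<^esub> f'')"
    by (auto simp: Z1_def fun_eq_iff)
next
  show "\<one>\<^bsub>Z1 G \<rho> W\<^esub> \<in> carrier (Z1 G \<rho> W)"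
    by (auto simp: Z1_def C1_zero[OF subspace_W] C1_action_eq linear_0[OF linear_\<rho>])
next
  fix f assume f: "f \<in> carrier (Z1 G \<rho> W)"
  show "\<one>\<^bsub>Z1 G \<rho> W\<^esub> \<otimes>\<^bsub>Z1 G \<rho> W\<^esub> f = f"
    using Z1_D(2)[OF f] by (auto simp: Z1_def fun_eq_iff extensional_def)
  let ?f = "\<lambda>g\<in>carrier G. \<lambda>Y. - f g Y"
  have "?f \<in> carrier (Z1 G \<rho> W)"
    using Z1_D[OF f]
    by (auto simp: Z1_def C1_action_eq linear_neg[OF linear_\<rho>] intro!: C1_minus subspace_W)
  moreover have "?f \<otimes>\<^bsub>Z1 G \<rho> W\<^esub> f = \<one>\<^bsub>Z1 G \<rho> W\<^esub>"
    by (auto simp: Z1_def fun_eq_iff)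
  ultimately show "\<exists>f'\<in>carrier (Z1 G \<rho> W). f' \<otimes>\<^bsub>Z1 G \<rho> W\<^esub> f = \<one>\<^bsub>Z1 G \<rho> W\<^esub>"
    by blast
qed

lemma coboundary_C1_cocycle: "c \<in> C1 W \<Longrightarrow> coboundary G \<rho> c \<in> carrier (Z1 G \<rho> W)"
  by (intro coboundary_cocycle C1_diff subspace_W C1_action_C1)

lemma B1_subgroup: "subgroup (B1 G \<rho> W) (Z1 G \<rho> W)"
proof -
  interpret Z: comm_group "Z1 G \<rho> W" by (rule Z1_comm_group)
  have zero: "coboundary G \<rho> (\<lambda>_. 0) = \<one>\<^bsub>Z1 G \<rho> W\<^esub>"
    by (auto simp: coboundary_def Z1_def fun_eq_iff C1_action_eq linear_0[OF linear_\<rho>])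
  show ?thesis
  proof
    show "B1 G \<rho> W \<subseteq> carrier (Z1 G \<rho> W)"
      by (auto simp: B1_def coboundary_C1_cocycle)
    show "\<one>\<^bsub>Z1 G \<rho> W\<^esub> \<in> B1 G \<rho> W"
      using zero C1_zero[OF subspace_W] by (force simp: B1_def)
  next
    fix f f' assume "f \<in> B1 G \<rho> W" "f' \<in> B1 G \<rho> W"
    then obtain c d where cd: "f = coboundary G \<rho> c" "f' = coboundary G \<rho> d" "c \<in> C1 W" "d \<in> C1 W"
      by (auto simp: B1_def)
    then have "f \<otimes>\<^bsub>Z1 G \<rho> W\<^esub> f' = coboundary G \<rho> (\<lambda>Y. c Y + d Y)"
      by (simp add: coboundary_add[where W = W])
    then show "f \<otimes>\<^bsub>Z1 G \<rho> W\<^esub> f' \<in> B1 G \<rho> W"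
      using cd C1_add[OF subspace_W] by (auto simp: B1_def)
  next
    fix f assume "f \<in> B1 G \<rho> W"
    then obtain c where c: "f = coboundary G \<rho> c" "c \<in> C1 W"
      by (auto simp: B1_def)
    have "coboundary G \<rho> (\<lambda>Y. - c Y) \<otimes>\<^bsub>Z1 G \<rho> W\<^esub> f = \<one>\<^bsub>Z1 G \<rho> W\<^esub>"
      using coboundary_add[of "\<lambda>Y. - c Y" c W] by (simp add: zero c)
    then have "inv\<^bsub>Z1 G \<rho> W\<^esub> f = coboundary G \<rho> (\<lambda>Y. - c Y)"
      by (rule Z.inv_equality) (simp_all add: c coboundary_C1_cocycle C1_minus subspace_W)
    then show "inv\<^bsub>Z1 G \<rho> W\<^esub> f \<in> B1 G \<rho> W"
      using c(2) C1_minus[OF subspace_W] by (auto simp: B1_def)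
  qed
qed

lemma H1_class_in_H1:
  assumes "f \<in> carrier (Z1 G \<rho> W)"
  shows "H1_class G \<rho> W f \<in> carrier (H1 G \<rho> W)"
  using assms by (simp add: H1_class_def H1_def carrier_FactGroup)

lemma H1_class_eq_one_iff:
  assumes f: "f \<in> carrier (Z1 G \<rho> W)"
  shows "H1_class G \<rho> W f = \<one>\<^bsub>H1 G \<rho> W\<^esub> \<longleftrightarrow> f \<in> B1 G \<rho> W"
proof -
  interpret Z: comm_group "Z1 G \<rho> W" by (rule Z1_comm_group)
  show ?thesis
    using Z.coset_join1[OF _ f B1_subgroup] Z.coset_join2[OF f B1_subgroup]
    by (auto simp: H1_class_def H1_def)
qed

text \<open>Maps \<open>c\<close> and \<open>d\<close> outside \<open>C1 W\<close> can have nontrivial classes; these agree once \<open>c\<close> and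
  \<open>d\<close> differ by an element of \<open>C1 W\<close>.\<close>

lemma H1_class_coboundary_eq:
  assumes c: "coboundary G \<rho> c \<in> carrier (Z1 G \<rho> W)" and d: "(\<lambda>Y. d Y - c Y) \<in> C1 W"
  shows "H1_class G \<rho> W (coboundary G \<rho> d) = H1_class G \<rho> W (coboundary G \<rho> c)"
proof -
  interpret Z: comm_group "Z1 G \<rho> W" by (rule Z1_comm_group)
  have "coboundary G \<rho> d = coboundary G \<rho> (\<lambda>Y. d Y - c Y) \<otimes>\<^bsub>Z1 G \<rho> W\<^esub> coboundary G \<rho> c"
    using coboundary_add[of "\<lambda>Y. d Y - c Y" c W] by simp
  then have "coboundary G \<rho> d \<in> B1 G \<rho> W #>\<^bsub>Z1 G \<rho> W\<^esub> coboundary G \<rho> c"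
    using d by (auto simp: r_coset_def B1_def)
  then show ?thesis
    using Z.repr_independence[OF _ c B1_subgroup] by (simp add: H1_class_def)
qed

end

section \<open>Momentum maps\<close>

context topological_lie_module
begin

lemma linear_act: "linear (act \<xi>)"
  using act_bilinear by (simp add: bilinear_def)

lemma continuous_act: "continuous_on UNIV (act \<xi>)"
proof -
  have "continuous_on UNIV (\<lambda>v. (\<xi>, v))"
    by (intro continuous_intros)
  from continuous_on_compose2[OF act_continuous this] show ?thesis
    by simp
qed

lemma subspace_V_inv: "subspace (V_inv act)"
  by (auto simp: subspace_def V_inv_def linear_0[OF linear_act] linear_add[OF linear_act]
      linear_scale[OF linear_act])

text \<open>Since \<open>L\<^sub>\<xi> \<omega> = 0\<close>, the differential of \<open>\<xi>.v\<close> is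
  \<open>L\<^sub>\<xi> (i\<^sub>\<eta> \<omega>) = i\<^bsub>[\<xi>, \<eta>]\<^esub> \<omega>\<close>, which is the differential of \<open>w\<close>. For a momentum map \<open>J\<close> the lemma is
  applied to \<open>v = J Z\<close> and \<open>w = J [X, Z]\<close>.\<close>

lemma infinitesimal_cocycle_invariant:
  assumes \<xi>: "\<xi> \<in> sp br act \<omega>" and v: "d0 act v = \<omega> \<eta>" and w: "d0 act w = \<omega> (br \<xi> \<eta>)"
  shows "act \<xi> v - w \<in> V_inv act"
proof -
  have "act \<nu> (act \<xi> v - w) = 0" for \<nu>
  proof -
    have "act \<xi> (\<omega> \<eta> \<nu>) - \<omega> (br \<xi> \<eta>) \<nu> - \<omega> \<eta> (br \<xi> \<nu>) = 0"
      using \<xi> by (simp add: sp_def lie_deriv_def fun_eq_iff)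
    moreover have "act \<mu> v = \<omega> \<eta> \<mu>" "act \<mu> w = \<omega> (br \<xi> \<eta>) \<mu>" for \<mu>
      using v w by (simp_all add: d0_def fun_eq_iff)
    moreover have "act \<nu> (act \<xi> v) = act \<xi> (act \<nu> v) - act (br \<xi> \<nu>) v"
      by (simp add: act_br)
    ultimately show ?thesis
      by (simp add: linear_diff[OF linear_act] algebra_simps)
  qed
  then show ?thesis by (simp add: V_inv_def)
qed

lemma momentum_map_diff:
  assumes "momentum_map br act \<omega> \<zeta> J" "momentum_map br act \<omega> \<zeta> J'"
  shows "(\<lambda>Y. J Y - J' Y) \<in> C1 (V_inv act)"
  using assms unfolding momentum_map_def C1_def
  by (auto intro!: linear_compose_sub continuous_on_diff simp: V_inv_def d0_def fun_eq_iff
      linear_diff[OF linear_act])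

text \<open>An invariant vector has zero differential, so the differentials do not change and the values stay in \<^const>\<open>V_ham\<close>.\<close>

lemma momentum_map_minus_invariant:
  assumes \<zeta>: "range \<zeta> \<subseteq> ham br act \<omega>" and J: "momentum_map br act \<omega> \<zeta> J" and c: "c \<in> C1 (V_inv act)"
  shows "momentum_map br act \<omega> \<zeta> (\<lambda>Y. J Y - c Y)"
proof -
  have d0: "d0 act (J Y - c Y) = \<omega> (\<zeta> Y)" for Y
    using J c by (auto simp: momentum_map_def C1_def V_inv_def d0_def fun_eq_iff linear_diff[OF linear_act])
  then have "J Y - c Y \<in> V_ham br act \<omega>" for Y
    using \<zeta> unfolding V_ham_def by blast
  then show ?thesis
    using d0 J c unfolding momentum_map_def C1_def
    by (auto intro!: linear_compose_sub continuous_on_diff)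
qed

end

lemma momentum_cocycle_eq_coboundary: "momentum_cocycle G \<rho> J = coboundary G \<rho> J"
  by (simp add: momentum_cocycle_def coboundary_def)

theorem proposition2p10:
  fixes G :: "('a, 'e::lcs, 'x::lcs) lie_group"
    and br :: "'h::tvs \<Rightarrow> 'h \<Rightarrow> 'h"
    and act :: "'h \<Rightarrow> 'v::lcs \<Rightarrow> 'v"
    and \<omega> :: "'h \<Rightarrow> 'h \<Rightarrow> 'v"
    and \<zeta> :: "'x \<Rightarrow> 'h"
    and \<rho> :: "'a \<Rightarrow> 'v \<Rightarrow> 'v"
    and J :: "'x \<Rightarrow> 'v"
  assumes "topological_lie_algebra br"
    and "topological_lie_module br act"
    and "\<omega> \<in> C2"
    and "connected_lie_group G"
    and "ham_hom G br act \<omega> \<zeta>"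
    and "hamiltonian_action G act \<zeta> \<rho>"
    and "momentum_map br act \<omega> \<zeta> J"
  shows "momentum_cocycle G \<rho> J \<in> carrier (Z1 G \<rho> (V_inv act))
    \<and> (equivariant G \<rho> J \<longleftrightarrow> momentum_cocycle G \<rho> J = \<one>\<^bsub>Z1 G \<rho> (V_inv act)\<^esub>)
    \<and> H1_class G \<rho> (V_inv act) (momentum_cocycle G \<rho> J) \<in> carrier (H1 G \<rho> (V_inv act))
    \<and> (\<forall>J'. momentum_map br act \<omega> \<zeta> J' \<longrightarrow>
         H1_class G \<rho> (V_inv act) (momentum_cocycle G \<rho> J') =
         H1_class G \<rho> (V_inv act) (momentum_cocycle G \<rho> J))
    \<and> ((\<exists>J'. momentum_map br act \<omega> \<zeta> J' \<and> equivariant G \<rho> J') \<longleftrightarrow>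
         H1_class G \<rho> (V_inv act) (momentum_cocycle G \<rho> J) = \<one>\<^bsub>H1 G \<rho> (V_inv act)\<^esub>)"
proof -
  interpret topological_lie_module br act by fact
  have conn: "connected_space (gtop G)"
    using assms(4) by (simp add: connected_lie_group_def)
  have \<zeta>: "range \<zeta> \<subseteq> ham br act \<omega>" "\<And>X Y. \<zeta> (lie_bracket G X Y) = br (\<zeta> X) (\<zeta> Y)"
    using assms(5) by (simp_all add: ham_hom_def)
  have derived: "derived_action G \<rho> X v = act (\<zeta> X) v" for X v
    using assms(6) by (simp add: hamiltonian_action_def)
  interpret Lie_group_action G \<rho>
    using assms(4,6) by unfold_locales (simp_all add: connected_lie_group_def hamiltonian_action_def)
  \<comment> \<open>the derived action of \<open>X\<close> is that of \<open>\<zeta> X\<close>, which kills invariant vectors\<close>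
  have trivial: "\<rho> g w = w" if "g \<in> carrier G" "w \<in> V_inv act" for g w
    using that by (intro \<rho>_eq_id_if_derived_action_zero[OF conn]) (simp_all add: derived V_inv_def)
  interpret invariant_subspace G \<rho> "V_inv act"
    by unfold_locales (simp_all add: subspace_V_inv trivial)
  have J: "linear J" "continuous_on UNIV J" "\<And>X. d0 act (J X) = \<omega> (\<zeta> X)"
    using assms(7) by (auto simp: momentum_map_def C1_def)
  have invariant_values: "C1_action G \<rho> g J Y - J Y \<in> V_inv act" if g: "g \<in> carrier G" for g Y
  proof -
    \<comment> \<open>the group does not act on \<open>\<hh>\<close>, so \<open>\<xi>\<close> is kept fixed while \<open>g\<close> moves\<close>
    have "act \<xi> (C1_action G \<rho> g J Y) = act \<xi> (C1_action G \<rho> \<one>\<^bsub>G\<^esub> J Y)" for \<xi>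
    proof (rule constant_if_derivative_zero[where F = "\<lambda>g. act \<xi> (C1_action G \<rho> g J Y)", OF conn _ g])
      fix g assume g: "g \<in> carrier G"
      have w: "derived_action G \<rho> X (J Z) - J (lie_bracket G X Z) \<in> V_inv act" for X Z
        unfolding derived
      proof (rule infinitesimal_cocycle_invariant)
        show "\<zeta> X \<in> sp br act \<omega>"
          using \<zeta>(1) by (auto simp: ham_def)
      qed (simp_all add: J(3) \<zeta>(2))
      have "act \<xi> (C1_action G \<rho> g (\<lambda>Z. derived_action G \<rho> X (J Z) - J (lie_bracket G X Z)) Y) = 0" for X
        using w[of X] \<rho>_W[OF g] by (simp add: C1_action_eq[OF g] V_inv_def)
      then show "has_hderiv (\<lambda>p. act \<xi> (C1_action G \<rho> (g \<otimes>\<^bsub>G\<^esub> \<psi> p) J Y)) p0 (\<lambda>_. 0)"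
        using has_hderiv_comp[OF C1_action_has_hderiv[where Y = Y, OF J(1,2) g]
            has_hderiv_linear[OF linear_act[of \<xi>] continuous_act]] by simp
    qed
    then show ?thesis
      by (simp add: V_inv_def C1_action_one linear_diff[OF linear_act])
  qed
  have cocycle: "coboundary G \<rho> J \<in> carrier (Z1 G \<rho> (V_inv act))"
  proof (rule coboundary_cocycle)
    fix g assume g: "g \<in> carrier G"
    \<comment> \<open>with \<open>UNIV\<close> as the invariant subspace, closure of \<^const>\<open>C1\<close> under the action says that \<open>g.J\<close> is linear and continuous\<close>
    interpret all: invariant_subspace G \<rho> UNIV
      by unfold_locales simp_all
    have "(\<lambda>Y. C1_action G \<rho> g J Y - J Y) \<in> C1 UNIV"
      using J by (intro C1_diff all.C1_action_C1 g) (simp_all add: C1_def)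
    then show "(\<lambda>Y. C1_action G \<rho> g J Y - J Y) \<in> C1 (V_inv act)"
      using invariant_values[OF g] by (auto simp: C1_def)
  qed
  have indep: "H1_class G \<rho> (V_inv act) (coboundary G \<rho> J') = H1_class G \<rho> (V_inv act) (coboundary G \<rho> J)"
    if "momentum_map br act \<omega> \<zeta> J'" for J'
    by (rule H1_class_coboundary_eq[OF cocycle momentum_map_diff[OF that assms(7)]])
  have "(\<exists>J'. momentum_map br act \<omega> \<zeta> J' \<and> equivariant G \<rho> J') \<longleftrightarrow> coboundary G \<rho> J \<in> B1 G \<rho> (V_inv act)"
  proof
    assume "\<exists>J'. momentum_map br act \<omega> \<zeta> J' \<and> equivariant G \<rho> J'"
    then obtain J' where J': "momentum_map br act \<omega> \<zeta> J'" "equivariant G \<rho> J'" by blast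
    interpret Z: comm_group "Z1 G \<rho> (V_inv act)" by (rule Z1_comm_group)
    have "coboundary G \<rho> J' = \<one>\<^bsub>Z1 G \<rho> (V_inv act)\<^esub>"
      using J'(2) by (simp add: coboundary_eq_one_iff_equivariant)
    then have "H1_class G \<rho> (V_inv act) (coboundary G \<rho> J) = \<one>\<^bsub>H1 G \<rho> (V_inv act)\<^esub>"
      using indep[OF J'(1)] H1_class_eq_one_iff[OF Z.one_closed] subgroup.one_closed[OF B1_subgroup] by simp
    then show "coboundary G \<rho> J \<in> B1 G \<rho> (V_inv act)"
      by (simp add: H1_class_eq_one_iff[OF cocycle])
  next
    assume "coboundary G \<rho> J \<in> B1 G \<rho> (V_inv act)"
    then obtain c where c: "c \<in> C1 (V_inv act)" "coboundary G \<rho> J = coboundary G \<rho> c"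
      by (auto simp: B1_def)
    have "C1_action G \<rho> g J Y - J Y = C1_action G \<rho> g c Y - c Y" if "g \<in> carrier G" for g Y
      using fun_cong[OF fun_cong[OF c(2), of g], of Y] that by (simp add: coboundary_def)
    then have "coboundary G \<rho> (\<lambda>Y. J Y - c Y) = \<one>\<^bsub>Z1 G \<rho> (V_inv act)\<^esub>"
      by (auto simp: coboundary_def Z1_def fun_eq_iff C1_action_diff algebra_simps)
    then show "\<exists>J'. momentum_map br act \<omega> \<zeta> J' \<and> equivariant G \<rho> J'"
      using momentum_map_minus_invariant[OF \<zeta>(1) assms(7) c(1)]
        coboundary_eq_one_iff_equivariant by blast
  qed
  then show ?thesis
    using cocycle indep H1_class_in_H1[OF cocycle] H1_class_eq_one_iff[OF cocycle]
      coboundary_eq_one_iff_equivariant[of J "V_inv act"]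
    by (simp add: momentum_cocycle_eq_coboundary)
qed

end
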